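(* Let $G=(\mathcal V,\mathcal E)$ be an acyclic network over $\mathbb F_q$, and let $S\neq T$ be nodes of $G$ (source and destination). Then the minimum value of all $S$-$T$ cuts satisfies $$mincut(S,T)=\min_{\Omega}\operatorname{rank}(G_\Omega)=\max_{\alpha_{(i,e)},\,\beta_{(e',e)},\,\epsilon_{(e',i)}}\operatorname{rank}(M),$$ where the minimum is over all cuts $\Omega$ between $S$ and $T$, and $M=A(I-F)^{-1}B^T$ is the system matrix from the source processes at $S$ to the destination processes at $T$; the maximum is over all choices of the coefficients in $\mathbb F_q$ (and over the numbers $\mu(S)\le|O(S)|$ of source processes and $\nu(T)$ of destination processes).
   Context: Network. $G=(\mathcal V,\mathcal E)$ consists of a finite set $\mathcal V$ of nodes; each node $V$ has a finite set $I(V)$ of input ports and a finite set $O(V)$ of output ports (all these sets are pairwise disjoint). Each edge in $\mathcal E$ is an ordered pair $(e_1,e_2)$ with $e_1\in O(V_1)$ and $e_2\in I(V_2)$ for some $V_1,V_2\in\mathcal V$. $G$ is acyclic if the directed graph on $\mathcal V$ with an arc $V_1\to V_2$ whenever some edge goes from $O(V_1)$ to $I(V_2)$ has no directed cycle. Let $e_1,e_2,\dots$ enumerate all ports, and let $\mathbb F_q$ be a finite field. Cuts. A cut between $S$ and $T$ is a set $\Omega\subseteq\mathcal V$ with $S\in\Omega$, $T\in\Omega^c$. $G_\Omega$ is the $0$-$1$ matrix over $\mathbb F_q$ with rows indexed by the output ports of nodes in $\Omega$ and columns by the input ports of nodes in $\Omega^c$, with entry $1$ exactly when there is an edge from the row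 port to the column port. System matrix. $F$ is the square matrix indexed by the ports with $F_{i,j}=1$ if $(e_i,e_j)\in\mathcal E$; $F_{i,j}=\beta_{(e_i,e_j)}$ if $e_i\in I(V)$ and $e_j\in O(V)$ for some node $V$; and $0$ otherwise. $A$ is $\mu(S)\times(\text{number of ports})$ with $A_{i,j}=\alpha_{(i,e_j)}$ if $e_j\in O(S)$ and $0$ otherwise. $B$ is $\nu(T)\times(\text{number of ports})$ with entry in row $k$, column $e_i$ equal to $\epsilon_{(e_i,(T,k))}$ if $e_i\in I(T)$ and $0$ otherwise. The coefficients $\alpha,\beta,\epsilon\in\mathbb F_q$ are free, and $M=A(I-F)^{-1}B^T$ ($I-F$ is invertible as $G$ is acyclic). $M$ describes the linear map from source symbols $\mathcal X(S)$ to destination symbols $\mathcal Z(T)=\mathcal X(S)M$ when nodes form their output-port symbols as linear combinations (coefficients $\beta$, and $\alpha$ at $S$) of their input-port symbols (and source symbols), every edge out of an output port carries that port's symbol, and symbols arriving at an input port are added in $\mathbb F_q$. *)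

theory Defs
  imports
    "Jordan_Normal_Form.DL_Rank"
    "Jordan_Normal_Form.Gauss_Jordan_Elimination"
begin

record ('v, 'p) network =
  nodes :: "'v set"
  inputs :: "'v \<Rightarrow> 'p set"
  outputs :: "'v \<Rightarrow> 'p set"
  edges :: "('p \<times> 'p) set"

definition network :: "('v, 'p) network \<Rightarrow> bool" where
  "network G \<longleftrightarrow>
     finite (nodes G) \<and>
     (\<forall>V\<in>nodes G. finite (inputs G V) \<and> finite (outputs G V)) \<and>
     (\<forall>V\<in>nodes G. \<forall>W\<in>nodes G. inputs G V \<inter> outputs G W = {}) \<and>
     (\<forall>V\<in>nodes G. \<forall>W\<in>nodes G. V \<noteq> W \<longrightarrow>
        inputs G V \<inter> inputs G W = {} \<and> outputs G V \<inter> outputs G W = {}) \<and>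
     edges G \<subseteq> (\<Union>V\<in>nodes G. outputs G V) \<times> (\<Union>V\<in>nodes G. inputs G V)"

definition ports :: "('v, 'p) network \<Rightarrow> 'p set" where
  "ports G = (\<Union>V\<in>nodes G. inputs G V \<union> outputs G V)"

definition node_arcs :: "('v, 'p) network \<Rightarrow> ('v \<times> 'v) set" where
  "node_arcs G = {(V, W). V \<in> nodes G \<and> W \<in> nodes G \<and>
     (\<exists>e\<in>outputs G V. \<exists>e'\<in>inputs G W. (e, e') \<in> edges G)}"

definition acyclic_network :: "('v, 'p) network \<Rightarrow> bool" where
  "acyclic_network G \<longleftrightarrow> network G \<and> acyclic (node_arcs G)"

text \<open>
  Matrices are indexed by natural numbers. Throughout, \<open>es\<close> is a list enumerating all ports
  without repetition, and port-indexed rows and columns follow the order of \<open>es\<close>.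
\<close>

definition mat_rank :: "'a::field mat \<Rightarrow> nat" where
  "mat_rank A = vec_space.rank (dim_row A) A"

definition is_cut :: "('v, 'p) network \<Rightarrow> 'v \<Rightarrow> 'v \<Rightarrow> 'v set \<Rightarrow> bool" where
  "is_cut G S T \<Omega> \<longleftrightarrow> \<Omega> \<subseteq> nodes G \<and> S \<in> \<Omega> \<and> T \<in> nodes G - \<Omega>"

definition cut_matrix :: "('v, 'p) network \<Rightarrow> 'p list \<Rightarrow> 'v set \<Rightarrow> 'a::field mat" where
  "cut_matrix G es \<Omega> =
     (let rs = filter (\<lambda>e. \<exists>V\<in>\<Omega>. e \<in> outputs G V) es;
          cs = filter (\<lambda>e. \<exists>V\<in>nodes G - \<Omega>. e \<in> inputs G V) es
      in mat (length rs) (length cs) (\<lambda>(i, j). if (rs ! i, cs ! j) \<in> edges G then 1 else 0))"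

text \<open>
  The field only enters through the rank, so it is passed as a type argument.
\<close>

definition mincut ::
  "'a::field itself \<Rightarrow> ('v, 'p) network \<Rightarrow> 'p list \<Rightarrow> 'v \<Rightarrow> 'v \<Rightarrow> nat" where
  "mincut _ G es S T = Min {mat_rank (cut_matrix G es \<Omega> :: 'a mat) | \<Omega>. is_cut G S T \<Omega>}"

definition F_mat ::
  "('v, 'p) network \<Rightarrow> 'p list \<Rightarrow> ('p \<times> 'p \<Rightarrow> 'a) \<Rightarrow> 'a::field mat" where
  "F_mat G es \<beta> = mat (length es) (length es) (\<lambda>(i, j).
     if (es ! i, es ! j) \<in> edges G then 1
     else if \<exists>V\<in>nodes G. es ! i \<in> inputs G V \<and> es ! j \<in> outputs G V then \<beta> (es ! i, es ! j)
     else 0)"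

text \<open>
  Source and destination processes are numbered from \<open>0\<close>, so \<open>\<alpha> (i, e)\<close> is used for \<open>i < \<mu>\<close>
  and \<open>\<epsilon> (e, (T, k))\<close> for \<open>k < \<nu>\<close>.
\<close>

definition A_mat ::
  "('v, 'p) network \<Rightarrow> 'p list \<Rightarrow> 'v \<Rightarrow> nat \<Rightarrow> (nat \<times> 'p \<Rightarrow> 'a) \<Rightarrow> 'a::field mat" where
  "A_mat G es S \<mu> \<alpha> = mat \<mu> (length es) (\<lambda>(i, j).
     if es ! j \<in> outputs G S then \<alpha> (i, es ! j) else 0)"

definition B_mat ::
  "('v, 'p) network \<Rightarrow> 'p list \<Rightarrow> 'v \<Rightarrow> nat \<Rightarrow> ('p \<times> ('v \<times> nat) \<Rightarrow> 'a) \<Rightarrow> 'a::field mat" where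
  "B_mat G es T \<nu> \<epsilon> = mat \<nu> (length es) (\<lambda>(k, i).
     if es ! i \<in> inputs G T then \<epsilon> (es ! i, (T, k)) else 0)"

text \<open>
  The use of \<open>the\<close> is harmless for acyclic networks, see \<open>I_minus_F_inverse\<close> below.
\<close>

definition system_matrix ::
  "('v, 'p) network \<Rightarrow> 'p list \<Rightarrow> 'v \<Rightarrow> 'v \<Rightarrow> nat \<Rightarrow> nat \<Rightarrow> (nat \<times> 'p \<Rightarrow> 'a) \<Rightarrow> ('p \<times> 'p \<Rightarrow> 'a) \<Rightarrow>
   ('p \<times> ('v \<times> nat) \<Rightarrow> 'a) \<Rightarrow> 'a::field mat" where
  "system_matrix G es S T \<mu> \<nu> \<alpha> \<beta> \<epsilon> =
     A_mat G es S \<mu> \<alpha> * the (mat_inverse (1\<^sub>m (length es) - F_mat G es \<beta>)) *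
     transpose_mat (B_mat G es T \<nu> \<epsilon>)"

lemma I_minus_F_inverse:
  fixes \<beta> :: "'p \<times> 'p \<Rightarrow> 'a::field"
  assumes G: "acyclic_network G" and es: "distinct es" "set es = ports G"
  obtains N where "mat_inverse (1\<^sub>m (length es) - F_mat G es \<beta>) = Some N"
    and "N \<in> carrier_mat (length es) (length es)"
    and "(1\<^sub>m (length es) - F_mat G es \<beta>) * N = 1\<^sub>m (length es)"
    and "N * (1\<^sub>m (length es) - F_mat G es \<beta>) = 1\<^sub>m (length es)"
proof -
  define n where "n = length es"
  define F where "F = F_mat G es \<beta>"
  define D where "D = 1\<^sub>m n - F"
  have F: "F \<in> carrier_mat n n" by (simp add: F_def F_mat_def n_def)
  have D: "D \<in> carrier_mat n n" using F unfolding D_def by (rule minus_carrier_mat)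
  have net: "network G" and ac: "acyclic (node_arcs G)"
    using G by (auto simp: acyclic_network_def)
  have disj: "p \<notin> outputs G W" if "V \<in> nodes G" "W \<in> nodes G" "p \<in> inputs G V" for V W p
    using net that by (auto simp: network_def)
  have same_node: "V = W"
    if "V \<in> nodes G" "W \<in> nodes G" "p \<in> inputs G V" "p \<in> inputs G W" for V W p
  proof (rule ccontr)
    assume "V \<noteq> W"
    then have "inputs G V \<inter> inputs G W = {}" using net that by (simp add: network_def)
    then show False using that by blast
  qed
  have edge: "(\<exists>V\<in>nodes G. p \<in> outputs G V) \<and> (\<exists>W\<in>nodes G. q \<in> inputs G W)"
    if "(p, q) \<in> edges G" for p q
    using net that by (auto simp: network_def)
  have no_edge: "(p, q) \<notin> edges G" if "V \<in> nodes G" "p \<in> inputs G V" for V p q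
    using edge disj that by blast
  have fin: "finite (node_arcs G)"
    by (rule finite_subset[of _ "nodes G \<times> nodes G"])
      (use net in \<open>auto simp: node_arcs_def network_def\<close>)
  have wf: "wf ((node_arcs G)\<inverse>)"
    using fin ac by (simp add: finite_acyclic_wf_converse)
  have "det D \<noteq> 0"
  proof
    assume "det D = 0"
    then obtain v where v: "v \<in> carrier_vec n" "v \<noteq> 0\<^sub>v n" "D *\<^sub>v v = 0\<^sub>v n"
      using det_0_iff_vec_prod_zero_field[OF D] by blast
    have eq: "v $ i = (\<Sum>j<n. F $$ (i, j) * v $ j)" if i: "i < n" for i
    proof -
      have "D *\<^sub>v v = 1\<^sub>m n *\<^sub>v v - F *\<^sub>v v"
        unfolding D_def using F v(1) by (intro minus_mult_distrib_mat_vec[where nc = n]) auto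
      then have "v - F *\<^sub>v v = 0\<^sub>v n" using v by simp
      then have "(v - F *\<^sub>v v) $ i = 0" using i by simp
      then have "v $ i = (F *\<^sub>v v) $ i" using i v(1) F by simp
      also have "\<dots> = (\<Sum>j<n. F $$ (i, j) * v $ j)"
        using i v(1) F by (auto simp: scalar_prod_def lessThan_atLeast0 intro!: sum.cong)
      finally show ?thesis .
    qed
    have zero: "V \<in> nodes G \<Longrightarrow> i < n \<Longrightarrow> es ! i \<in> inputs G V \<union> outputs G V \<Longrightarrow> v $ i = 0" for V i
      using wf
    proof (induction V arbitrary: i rule: wf_induct_rule)
      case (less V)
      have out: "v $ i = 0" if i: "i < n" and o: "es ! i \<in> outputs G V" for i
      proof -
        have "F $$ (i, j) * v $ j = 0" if j: "j < n" for j
        proof (cases "(es ! i, es ! j) \<in> edges G")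
          case True
          then obtain W where W: "W \<in> nodes G" "es ! j \<in> inputs G W"
            using edge by blast
          then have "(W, V) \<in> (node_arcs G)\<inverse>"
            using True o less.prems(1) by (auto simp: node_arcs_def)
          then have "v $ j = 0" using less.IH W j by blast
          then show ?thesis by simp
        next
          case False
          have "\<not> (\<exists>V'\<in>nodes G. es ! i \<in> inputs G V' \<and> es ! j \<in> outputs G V')"
            using disj o less.prems(1) by blast
          then have "F $$ (i, j) = 0"
            using False i j unfolding F_def F_mat_def n_def by (simp only: index_mat split if_False)
          then show ?thesis by simp
        qed
        then have "(\<Sum>j<n. F $$ (i, j) * v $ j) = 0" by (intro sum.neutral) blast
        then show ?thesis using eq[OF i] by (rule trans[rotated])
      qed
      show ?case
      proof (cases "es ! i \<in> outputs G V")
        case True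
        then show ?thesis using out less.prems by blast
      next
        case False
        then have inp: "es ! i \<in> inputs G V" using less.prems by blast
        have "F $$ (i, j) * v $ j = 0" if j: "j < n" for j
        proof (cases "\<exists>V'\<in>nodes G. es ! i \<in> inputs G V' \<and> es ! j \<in> outputs G V'")
          case True
          then obtain V' where V': "V' \<in> nodes G" "es ! i \<in> inputs G V'" "es ! j \<in> outputs G V'"
            by blast
          then have "V' = V" using same_node inp less.prems(1) by blast
          then have "es ! j \<in> outputs G V" using V' by simp
          then show ?thesis using out j by simp
        next
          case f: False
          have "(es ! i, es ! j) \<notin> edges G"
            using no_edge inp less.prems(1) by blast
          then have "F $$ (i, j) = 0"
            using f less.prems(2) j unfolding F_def F_mat_def n_def by (simp only: index_mat split if_False)
          then show ?thesis by simp
        qed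
        then have "(\<Sum>j<n. F $$ (i, j) * v $ j) = 0" by (intro sum.neutral) blast
        then show ?thesis using eq[OF less.prems(2)] by (rule trans[rotated])
      qed
    qed
    have "v $ i = 0" if "i < n" for i
    proof -
      have "es ! i \<in> ports G" using that es(2) nth_mem[of i es] by (simp only: n_def)
      then obtain V where "V \<in> nodes G" "es ! i \<in> inputs G V \<union> outputs G V"
        unfolding ports_def by (rule UN_E) (rule that)
      then show ?thesis using zero[OF _ that] by blast
    qed
    then have "v = 0\<^sub>v n" using v(1) by (intro eq_vecI) simp_all
    with v(2) show False by simp
  qed
  then have unit: "D \<in> Units (ring_mat TYPE('a) n ())"
    by (rule det_non_zero_imp_unit[OF D])
  have "mat_inverse D \<noteq> None"
  proof
    assume "mat_inverse D = None"
    then have "D \<notin> Units (ring_mat TYPE('a) n ())" by (rule mat_inverse(1)[OF D])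
    then show False using unit by (rule notE)
  qed
  then obtain N where N: "mat_inverse D = Some N"
    by (cases "mat_inverse D") simp_all
  show thesis
    using that[of N] N mat_inverse(2)[OF D N] by (simp add: D_def F_def n_def)
qed

text \<open>
  \<open>Min\<close> and \<open>Max\<close> are meaningful only on finite nonempty sets; the following two lemmas
  show that the sets of ranks to which they are applied have this property.
\<close>

lemma cut_ranks_finite_nonempty:
  assumes "network G" "S \<in> nodes G" "T \<in> nodes G" "S \<noteq> T"
  shows "finite {mat_rank (cut_matrix G es \<Omega> :: 'a::field mat) | \<Omega>. is_cut G S T \<Omega>}"
    and "{mat_rank (cut_matrix G es \<Omega> :: 'a::field mat) | \<Omega>. is_cut G S T \<Omega>} \<noteq> {}"
proof -
  have "finite {\<Omega>. is_cut G S T \<Omega>}"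
    by (rule finite_subset[of _ "Pow (nodes G)"])
      (use assms in \<open>auto simp: is_cut_def network_def\<close>)
  then show "finite {mat_rank (cut_matrix G es \<Omega> :: 'a mat) | \<Omega>. is_cut G S T \<Omega>}"
    by simp
  have "is_cut G S T {S}" using assms by (auto simp: is_cut_def)
  then show "{mat_rank (cut_matrix G es \<Omega> :: 'a mat) | \<Omega>. is_cut G S T \<Omega>} \<noteq> {}"
    by blast
qed

lemma system_ranks_finite_nonempty:
  fixes G :: "('v, 'p) network" and es :: "'p list" and S T :: 'v
  defines "R \<equiv> {mat_rank (system_matrix G es S T \<mu> \<nu> \<alpha> \<beta> \<epsilon> :: 'a::field mat) | \<mu> \<nu> \<alpha> \<beta> \<epsilon>.
                  \<mu> \<le> card (outputs G S)}"
  shows "finite R" and "R \<noteq> {}"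
proof -
  have le: "mat_rank (M :: 'a mat) \<le> dim_row M" for M
  proof -
    interpret vec_space "TYPE('a)" "dim_row M" .
    have M: "M \<in> carrier_mat (dim_row M) (dim_col M)" by simp
    have indpt: "lin_indpt {}" unfolding lin_dep_def by blast
    obtain B where B: "maximal B (\<lambda>X. X \<subseteq> set (cols M) \<and> lin_indpt X)"
    proof -
      have "\<exists>B. finite B \<and> maximal B (\<lambda>X. X \<subseteq> set (cols M) \<and> lin_indpt X) \<and> {} \<subseteq> B"
        by (rule maximal_exists_superset[of "set (cols M)"]) (use indpt in \<open>simp_all only: finite_set empty_subsetI simp_thms\<close>)
      then show thesis using that by blast
    qed
    have B': "B \<subseteq> carrier_vec (dim_row M)" "lin_indpt B"
      using B cols_dim[of M] unfolding maximal_def by blast+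
    have "card B \<le> dim" by (rule li_le_dim(2)[OF fin_dim B'])
    then show ?thesis
      using rank_card_indpt[OF M B] dim_is_n by (simp add: mat_rank_def)
  qed
  have "R \<subseteq> {..card (outputs G S)}"
    unfolding R_def using le by (fastforce simp: system_matrix_def A_mat_def intro: order_trans)
  then show "finite R" by (rule finite_subset) simp
  show "R \<noteq> {}" unfolding R_def by blast
qed

end

theory Submission
  imports Defs "HOL-Library.Function_Algebras" "HOL-Computational_Algebra.Polynomial_Factorial"
begin

text \<open>
  Work with the columns of \<open>I - F\<close> as vectors indexed by ports. For a set \<open>U\<close> of nodes avoiding
  \<open>S\<close> and \<open>T\<close> and a cut \<open>(\<Omega>, W)\<close> of the remaining nodes, consider the submatrix of \<open>I - F\<close>
  whose rows are the ports of \<open>U\<close> and the outputs of \<open>\<Omega>\<close> and whose columns are the ports of \<open>U\<close>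
  and the inputs of \<open>W\<close>. For \<open>U = {}\<close> it is \<open>- G\<^sub>\<Omega>\<close>, for \<open>U = nodes G - {S, T}\<close> its rank
  beyond the number of ports of \<open>U\<close> is the rank of the transfer from the outputs of \<open>S\<close> to the
  inputs of \<open>T\<close>. Over an infinite field the coefficients of a node \<open>V\<close> can be chosen such that
  the lower bound on all these ranks survives the passage from \<open>U\<close> to \<open>insert V U\<close>: for each
  output port of \<open>V\<close> only finitely many spans have to be avoided, and the cuts \<open>\<Omega>\<close> and
  \<open>insert V \<Omega>\<close> for \<open>U\<close> bound what is needed for \<open>\<Omega>\<close> and \<open>insert V U\<close>. Each coefficient occurs in
  a single entry of \<open>I - F\<close>, so that the coefficients found over the field of rational functions
  can be replaced one by one by 0 or 1 without decreasing the rank. Hence every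
  finite field suffices, however small.

  Conversely, symbols that vanish on all edges across a cut vanish behind the cut, because the
  network is acyclic; so the system matrix has at most the rank of the cut matrix.
\<close>

subsection \<open>Dimensions of spans of finite sets\<close>

context vector_space
begin

text \<open>The ambient space need not be finite-dimensional. A basis chosen inside the finite set
  \<open>W\<close> bounds every independent set in its span by exchange.\<close>

lemma independent_card_le_dim_finite:
  assumes "finite W" "independent B" "B \<subseteq> span W"
  shows "finite B" "card B \<le> dim W"
proof -
  obtain C where C: "C \<subseteq> W" "independent C" "W \<subseteq> span C" "card C = dim W"
    using basis_exists .
  have "finite C" using C(1) assms(1) finite_subset by blast
  moreover have "B \<subseteq> span C"
    using assms(3) C(3) span_minimal[OF C(3) subspace_span] by blast
  ultimately show "finite B" "card B \<le> dim W"
    using independent_span_bound[OF _ assms(2), of C] C(4) by auto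
qed

lemma dim_mono_finite:
  assumes "finite W" "V \<subseteq> span W"
  shows "dim V \<le> dim W"
proof -
  obtain C where C: "C \<subseteq> V" "independent C" "V \<subseteq> span C" "card C = dim V"
    using basis_exists .
  then show ?thesis
    using independent_card_le_dim_finite(2)[OF assms(1) C(2)] assms(2) by auto
qed

lemma dim_insert_finite:
  assumes "finite S"
  shows "dim (insert x S) = (if x \<in> span S then dim S else Suc (dim S))"
proof (cases "x \<in> span S")
  case True
  then show ?thesis using span_eq_dim[OF span_redundant[OF True]] by simp
next
  case False
  obtain C where C: "C \<subseteq> S" "independent C" "S \<subseteq> span C" "card C = dim S"
    using basis_exists .
  have fin: "finite C" using C(1) assms finite_subset by blast
  have x: "x \<notin> span C" using False span_mono[OF C(1)] by blast
  have "dim (insert x S) = Suc (dim S)"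
  proof (rule dim_unique)
    show "insert x C \<subseteq> insert x S" using C(1) by blast
    show "insert x S \<subseteq> span (insert x C)"
      using C(3) span_mono[of C "insert x C"] span_base[of x "insert x C"] by blast
    show "independent (insert x C)" using x C(2) by (rule independent_insertI)
    show "card (insert x C) = Suc (dim S)"
      using fin x C(4) span_base[of x C] by (auto simp: card_insert_if)
  qed
  then show ?thesis using False by simp
qed

lemma dim_Un_le:
  assumes "finite A" "finite B"
  shows "dim (A \<union> B) \<le> dim A + card B"
  using assms(2)
proof induction
  case (insert x B)
  then show ?case using assms(1) dim_insert_finite[of "A \<union> B" x] by auto
qed simp

text \<open>Independence is phrased by coefficients on the index set, which suits the comparison of
  two families over the same indices. It excludes repeated vectors, so the image is an independent
  set with \<open>card J\<close> elements.\<close>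

lemma family_le_dim:
  assumes "finite W" "finite J" "\<And>j. j \<in> J \<Longrightarrow> x j \<in> span W"
    and "\<And>a. (\<Sum>j\<in>J. scale (a j) (x j)) = 0 \<Longrightarrow> \<forall>j\<in>J. a j = 0"
  shows "card J \<le> dim W"
proof -
  have inj: "inj_on x J"
  proof (rule inj_onI, rule ccontr)
    fix i j assume ij: "i \<in> J" "j \<in> J" "x i = x j" "i \<noteq> j"
    \<comment> \<open>Two equal members would satisfy the nontrivial relation with coefficients 1
      and -1.\<close>
    define a :: "'c \<Rightarrow> 'a" where "a k = (if k = i then 1 else if k = j then - 1 else 0)" for k
    have "(\<Sum>k\<in>J. scale (a k) (x k)) = (\<Sum>k\<in>{i, j}. scale (a k) (x k))"
      using assms(2) ij by (intro sum.mono_neutral_right) (auto simp: a_def)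
    also have "\<dots> = 0" using ij by (simp add: a_def scale_minus_left)
    finally have "\<forall>k\<in>J. a k = 0" using assms(4)[of a] by blast
    then have "a i = 0" using ij(1) by blast
    then show False by (simp add: a_def)
  qed
  have "independent (x ` J)"
  proof (rule independent_if_scalars_zero)
    fix f v assume f: "(\<Sum>v\<in>x ` J. scale (f v) v) = 0" and v: "v \<in> x ` J"
    have "(\<Sum>j\<in>J. scale (f (x j)) (x j)) = 0"
      using f inj by (simp add: sum.reindex)
    then show "f v = 0" using assms(4)[of "f \<circ> x"] v by auto
  qed (use assms(2) in simp)
  moreover have "card (x ` J) = card J" using inj by (rule card_image)
  ultimately show ?thesis
    using independent_card_le_dim_finite(2)[OF assms(1), of "x ` J"] assms(3) by auto
qed

text \<open>The coefficients are chosen one after another. If \<open>e i\<close> lies outside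
  \<open>span B\<close>, the line of all \<open>v - scale t (e i)\<close> meets
  \<open>span B\<close> in at most one point. So finitely many values of \<open>t\<close> are
  forbidden, and an infinite field has one left.\<close>

lemma generic_combination:
  assumes inf: "infinite (UNIV :: 'a set)" and "finite I" and fin: "finite \<B>"
  shows "\<exists>b. \<forall>B\<in>\<B>. w - (\<Sum>i\<in>I. scale (b i) (e i)) \<in> span B \<longrightarrow> e ` I \<subseteq> span B"
  using \<open>finite I\<close>
proof induction
  case (insert i I)
  then obtain b where
    b: "\<forall>B\<in>\<B>. w - (\<Sum>i\<in>I. scale (b i) (e i)) \<in> span B \<longrightarrow> e ` I \<subseteq> span B" by blast
  define v where "v = w - (\<Sum>i\<in>I. scale (b i) (e i))"
  define bad where "bad B = {t. e i \<notin> span B \<and> v - scale t (e i) \<in> span B}" for B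
  have "finite (bad B)" for B
  proof -
    have "s = t" if "s \<in> bad B" "t \<in> bad B" for s t
    proof (rule ccontr)
      assume "s \<noteq> t"
      have "(v - scale s (e i)) - (v - scale t (e i)) \<in> span B"
        using that by (intro span_diff[of "v - scale s (e i)"]) (simp_all add: bad_def)
      then have "scale (t - s) (e i) \<in> span B" by (simp add: scale_left_diff_distrib)
      then have "scale (inverse (t - s)) (scale (t - s) (e i)) \<in> span B" by (rule span_scale)
      then have "e i \<in> span B" using \<open>s \<noteq> t\<close> by simp
      then show False using that by (simp add: bad_def)
    qed
    then have "bad B = {} \<or> (\<exists>t. bad B = {t})" by blast
    then show ?thesis by auto
  qed
  then have "finite (\<Union>B\<in>\<B>. bad B)" using fin by blast
  then obtain t where t: "t \<notin> (\<Union>B\<in>\<B>. bad B)" using inf ex_new_if_finite by blast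
  have sum: "w - (\<Sum>j\<in>insert i I. scale ((b(i := t)) j) (e j)) = v - scale t (e i)"
  proof -
    have "(\<Sum>j\<in>I. scale ((b(i := t)) j) (e j)) = (\<Sum>j\<in>I. scale (b j) (e j))"
      using insert.hyps by (intro sum.cong) auto
    then show ?thesis using insert.hyps by (simp add: v_def algebra_simps)
  qed
  show ?case
  proof (rule exI[of _ "b(i := t)"], intro ballI impI)
    fix B assume B: "B \<in> \<B>"
      and "w - (\<Sum>j\<in>insert i I. scale ((b(i := t)) j) (e j)) \<in> span B"
    then have v: "v - scale t (e i) \<in> span B" unfolding sum by blast
    have ei: "e i \<in> span B" using t B v by (auto simp: bad_def)
    have "(v - scale t (e i)) + scale t (e i) \<in> span B"
      using v ei by (intro span_add span_scale)
    then have "v \<in> span B" by simp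
    then show "e ` insert i I \<subseteq> span B" using b B ei by (auto simp: v_def)
  qed
qed simp

text \<open>
  Appending to \<open>A\<close> the vectors \<open>w o'\<close>, each modified by a generic combination of the \<open>e i\<close>: as long
  as a modified vector is not independent of its predecessors, all \<open>e i\<close> are already spanned.
\<close>

lemma generic_extension:
  assumes inf: "infinite (UNIV :: 'a set)" and "finite O'" and I: "finite I"
    and \<A>: "finite \<A>" "\<And>A. A \<in> \<A> \<Longrightarrow> finite A"
  shows "\<exists>b. \<forall>A\<in>\<A>. min (dim A + card O') (dim (A \<union> e ` I \<union> w ` O'))
    \<le> dim (A \<union> (\<lambda>o'. w o' - (\<Sum>i\<in>I. scale (b (i, o')) (e i))) ` O')"
proof -
  define x where "x b o' = w o' - (\<Sum>i\<in>I. scale (b (i, o')) (e i))" for b o'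
  have "\<exists>b. \<forall>A\<in>\<A>. dim A + card O' \<le> dim (A \<union> x b ` O') \<or> e ` I \<subseteq> span (A \<union> x b ` O')"
    using \<open>finite O'\<close>
  proof induction
    case (insert o' O')
    then obtain b where
      b: "\<forall>A\<in>\<A>. dim A + card O' \<le> dim (A \<union> x b ` O') \<or> e ` I \<subseteq> span (A \<union> x b ` O')" by blast
    \<comment> \<open>One choice serves all members of \<A> at once, since only the spans of the
      finitely many sets built so far have to be avoided.\<close>
    obtain b' where b': "\<forall>B\<in>(\<lambda>A. A \<union> x b ` O') ` \<A>.
        w o' - (\<Sum>i\<in>I. scale (b' i) (e i)) \<in> span B \<longrightarrow> e ` I \<subseteq> span B"
      using generic_combination[OF inf I, of "(\<lambda>A. A \<union> x b ` O') ` \<A>" "w o'" e] \<A>(1) by blast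
    define c where "c = (\<lambda>(i, q). if q = o' then b' i else b (i, q))"
    have xo: "x c o' = w o' - (\<Sum>i\<in>I. scale (b' i) (e i))" by (simp add: x_def c_def)
    have xO: "x c ` O' = x b ` O'"
    proof (rule image_cong[OF refl])
      fix q assume "q \<in> O'"
      then have "q \<noteq> o'" using insert.hyps by blast
      then show "x c q = x b q" by (simp add: x_def c_def)
    qed
    show ?case
    proof (intro exI ballI)
      fix A assume A: "A \<in> \<A>"
      have eq: "A \<union> x c ` insert o' O' = insert (x c o') (A \<union> x b ` O')" using xO by auto
      have fin: "finite (A \<union> x b ` O')" using \<A>(2)[OF A] insert.hyps by blast
      have "e ` I \<subseteq> span (A \<union> x c ` insert o' O')" if "e ` I \<subseteq> span (A \<union> x b ` O')"
        unfolding eq using that span_mono[of "A \<union> x b ` O'"] by blast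
      moreover have "e ` I \<subseteq> span (A \<union> x b ` O')" if "x c o' \<in> span (A \<union> x b ` O')"
        using b' that A xo by simp
      moreover have "dim (A \<union> x c ` insert o' O') = Suc (dim (A \<union> x b ` O'))"
        if "x c o' \<notin> span (A \<union> x b ` O')"
        using that dim_insert_finite[OF fin] eq by simp
      ultimately show "dim A + card (insert o' O') \<le> dim (A \<union> x c ` insert o' O')
        \<or> e ` I \<subseteq> span (A \<union> x c ` insert o' O')"
        using b A insert.hyps by fastforce
    qed
  qed simp
  then obtain b where
    b: "\<forall>A\<in>\<A>. dim A + card O' \<le> dim (A \<union> x b ` O') \<or> e ` I \<subseteq> span (A \<union> x b ` O')" by blast
  have "min (dim A + card O') (dim (A \<union> e ` I \<union> w ` O')) \<le> dim (A \<union> x b ` O')" if A: "A \<in> \<A>" for A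
  proof (cases "e ` I \<subseteq> span (A \<union> x b ` O')")
    case True
    \<comment> \<open>Adding the combination of the \<open>e i\<close> back recovers
      \<open>w q\<close> from the modified vector.\<close>
    have "w q \<in> span (A \<union> x b ` O')" if "q \<in> O'" for q
    proof -
      have "x b q + (\<Sum>i\<in>I. scale (b (i, q)) (e i)) \<in> span (A \<union> x b ` O')"
        using True that by (intro span_add span_sum span_scale) (auto intro: span_base)
      then show ?thesis by (simp add: x_def)
    qed
    then have "A \<union> e ` I \<union> w ` O' \<subseteq> span (A \<union> x b ` O')"
      using True by (auto intro: span_base)
    then have "dim (A \<union> e ` I \<union> w ` O') \<le> dim (A \<union> x b ` O')"
      using \<A>(2)[OF A] \<open>finite O'\<close> by (intro dim_mono_finite) auto
    then show ?thesis by simp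
  next
    case False
    then have "dim A + card O' \<le> dim (A \<union> x b ` O')" using b A by blast
    then show ?thesis by simp
  qed
  then show ?thesis unfolding x_def by blast
qed

text \<open>Adjoining a vector raises the dimension by 0 or 1. If neither \<open>w\<close> nor
  \<open>w - e\<close> enlarges the span of \<open>B\<close>, then \<open>e\<close> and hence every
  \<open>w - scale t e\<close> lies in it.\<close>

lemma dim_insert_zero_one:
  assumes "finite B"
  shows "dim (insert (w - scale t e) B) \<le> max (dim (insert w B)) (dim (insert (w - e) B))"
proof (rule ccontr)
  assume "\<not> ?thesis"
  then have *: "dim (insert w B) < dim (insert (w - scale t e) B)"
    "dim (insert (w - e) B) < dim (insert (w - scale t e) B)" by auto
  then have "w \<in> span B" "w - e \<in> span B" "w - scale t e \<notin> span B"
    using dim_insert_finite[OF assms] by (auto split: if_splits)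
  moreover from this(1,2) have "w - (w - e) \<in> span B" by (rule span_diff)
  then have "scale t e \<in> span B" using span_scale[of e B t] by simp
  with \<open>w \<in> span B\<close> have "w - scale t e \<in> span B" by (rule span_diff)
  ultimately show False by blast
qed

end

subsection \<open>Vectors indexed by ports\<close>

text \<open>Vectors are functions on the whole type of ports. This space may be
  infinite-dimensional, so dimensions are taken of finite generating sets.\<close>

definition fscale :: "'k::field \<Rightarrow> ('p \<Rightarrow> 'k) \<Rightarrow> 'p \<Rightarrow> 'k" where
  "fscale c f = (\<lambda>x. c * f x)"

lemma fscale_apply: "fscale c f x = c * f x"
  by (simp add: fscale_def)

interpretation fv: vector_space fscale
  by unfold_locales (auto simp: fun_eq_iff fscale_apply algebra_simps)

lemma sum_fun_apply: "(\<Sum>i\<in>A. f i) x = (\<Sum>i\<in>A. (f i x :: 'k::ab_group_add))"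
  by (induction A rule: infinite_finite_induct) auto

definition unit_fun :: "'p \<Rightarrow> 'p \<Rightarrow> 'k::field" where
  "unit_fun p = (\<lambda>q. if q = p then 1 else 0)"

lemma unit_fun_apply: "unit_fun p q = (if q = p then 1 else 0)"
  by (simp add: unit_fun_def)

lemma span_vanishing:
  assumes "v \<in> fv.span B" "\<And>w. w \<in> B \<Longrightarrow> w c = 0"
  shows "v c = 0"
  using assms(1)
proof (induction rule: fv.span_induct_alt)
  case base
  then show ?case by simp
next
  case (step a x y)
  then show ?case using assms(2) by (simp add: fscale_apply)
qed

text \<open>The vectors \<open>w c\<close> are added one at a time. At coordinate \<open>c\<close>
  every vector already present vanishes while \<open>w c\<close> is 1, so each raises the
  dimension.\<close>

lemma dim_Un_unit_coordinates:
  assumes "finite B" "finite C"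
    and "\<And>v c. v \<in> B \<Longrightarrow> c \<in> C \<Longrightarrow> v c = 0"
    and "\<And>c c'. c \<in> C \<Longrightarrow> c' \<in> C \<Longrightarrow> w c' c = (if c = c' then 1 else 0)"
  shows "fv.dim B + card C \<le> fv.dim (B \<union> w ` C)"
  using assms(2-)
proof (induction)
  case (insert c C)
  have "w c \<notin> fv.span (B \<union> w ` C)"
  proof
    assume "w c \<in> fv.span (B \<union> w ` C)"
    then have "w c c = 0"
      by (rule span_vanishing) (use insert.prems insert.hyps in auto)
    then show False using insert.prems(2)[of c c] by simp
  qed
  then have "fv.dim (insert (w c) (B \<union> w ` C)) = Suc (fv.dim (B \<union> w ` C))"
    using assms(1) insert.hyps fv.dim_insert_finite[of "B \<union> w ` C" "w c"] by simp
  moreover have "fv.dim B + card C \<le> fv.dim (B \<union> w ` C)"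
    using insert.prems by (intro insert.IH) auto
  ultimately show ?case using insert.hyps by simp
qed simp

text \<open>In the elimination, \<open>u\<close> gives the unit vectors at the inputs of a node and
  \<open>w\<close> their columns in \<open>I - F\<close>: deleted rows are traded for columns. Any
  \<open>u\<close> contributes at most \<open>card C\<close>, while \<open>w\<close> contributes the
  full amount.\<close>

corollary dim_Un_unit_coordinates_replace:
  assumes "finite B" "finite C"
    and "\<And>v c. v \<in> B \<Longrightarrow> c \<in> C \<Longrightarrow> v c = 0"
    and "\<And>c c'. c \<in> C \<Longrightarrow> c' \<in> C \<Longrightarrow> w c' c = (if c = c' then 1 else 0)"
  shows "fv.dim (B \<union> u ` C) \<le> fv.dim (B \<union> w ` C)"
proof -
  have "fv.dim (B \<union> u ` C) \<le> fv.dim B + card (u ` C)"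
    using assms by (intro fv.dim_Un_le) auto
  also have "\<dots> \<le> fv.dim B + card C" using assms(2) by (simp add: card_image_le)
  also have "\<dots> \<le> fv.dim (B \<union> w ` C)" by (rule dim_Un_unit_coordinates) fact+
  finally show ?thesis .
qed

subsection \<open>Elimination of nodes\<close>

definition ins :: "('v, 'p) network \<Rightarrow> 'v set \<Rightarrow> 'p set" where
  "ins G X = (\<Union>V\<in>X. inputs G V)"

definition outs :: "('v, 'p) network \<Rightarrow> 'v set \<Rightarrow> 'p set" where
  "outs G X = (\<Union>V\<in>X. outputs G V)"

lemma ins_insert [simp]: "ins G (insert V X) = inputs G V \<union> ins G X"
  by (simp add: ins_def)

lemma outs_insert [simp]: "outs G (insert V X) = outputs G V \<union> outs G X"
  by (simp add: outs_def)

lemma ins_empty [simp]: "ins G {} = {}" and outs_empty [simp]: "outs G {} = {}"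
  by (simp_all add: ins_def outs_def)

text \<open>The entries of \<open>F\<close>, indexed by ports in place of positions in an
  enumeration.\<close>

definition coef :: "('v, 'p) network \<Rightarrow> ('p \<times> 'p \<Rightarrow> 'k) \<Rightarrow> 'p \<Rightarrow> 'p \<Rightarrow> 'k::field" where
  "coef G \<beta> p q = (if (p, q) \<in> edges G then 1
     else if \<exists>V\<in>nodes G. p \<in> inputs G V \<and> q \<in> outputs G V then \<beta> (p, q) else 0)"

text \<open>The column of \<open>I - F\<close> belonging to a port.\<close>

definition col_fun :: "('v, 'p) network \<Rightarrow> ('p \<times> 'p \<Rightarrow> 'k) \<Rightarrow> 'p \<Rightarrow> 'p \<Rightarrow> 'k::field" where
  "col_fun G \<beta> q = (\<lambda>p. unit_fun q p - coef G \<beta> p q)"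

text \<open>A coefficient enters the column of its second port only, so changing the coefficients
  into the outputs of one node leaves all other columns fixed.\<close>

lemma col_cong:
  assumes "\<And>p. \<beta>' (p, q) = \<beta> (p, q)"
  shows "col_fun G \<beta>' q = col_fun G \<beta> q"
  by (simp add: col_fun_def coef_def assms cong: if_cong)

text \<open>
  Deleting a row amounts to adding the corresponding unit vector to the columns: the dimension of
  \<open>gens G \<beta> U \<Omega> W\<close> is the rank of the submatrix of \<open>I - F\<close> with rows \<open>ins U\<close>, \<open>outs U\<close>,
  \<open>outs \<Omega>\<close> and columns \<open>ins U\<close>, \<open>outs U\<close>, \<open>ins W\<close>, plus the number of deleted rows.
\<close>

definition gens ::
  "('v, 'p) network \<Rightarrow> ('p \<times> 'p \<Rightarrow> 'k) \<Rightarrow> 'v set \<Rightarrow> 'v set \<Rightarrow> 'v set \<Rightarrow> ('p \<Rightarrow> 'k::field) set" where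
  "gens G \<beta> U \<Omega> W = col_fun G \<beta> ` (ins G U \<union> outs G U \<union> ins G W)
     \<union> unit_fun ` (ins G \<Omega> \<union> ins G W \<union> outs G W)"

context
  fixes G :: "('v, 'p) network"
  assumes net: "network G"
begin

section \<open>Finiteness and disjointness of the sets of ports\<close>

lemma finite_nodes: "finite (nodes G)"
  using net by (simp add: network_def)

lemma finite_inputs: "V \<in> nodes G \<Longrightarrow> finite (inputs G V)"
  and finite_outputs: "V \<in> nodes G \<Longrightarrow> finite (outputs G V)"
  using net by (auto simp: network_def)

lemma finite_ins: "X \<subseteq> nodes G \<Longrightarrow> finite (ins G X)"
  and finite_outs: "X \<subseteq> nodes G \<Longrightarrow> finite (outs G X)"
  using finite_subset[OF _ finite_nodes] finite_inputs finite_outputs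
  by (auto simp: ins_def outs_def)

lemma ports_eq: "ports G = ins G (nodes G) \<union> outs G (nodes G)"
  by (auto simp: ports_def ins_def outs_def)

lemma finite_ports: "finite (ports G)"
  by (simp add: ports_eq finite_ins finite_outs)

lemma inputs_unique:
  "V \<in> nodes G \<Longrightarrow> W \<in> nodes G \<Longrightarrow> p \<in> inputs G V \<Longrightarrow> p \<in> inputs G W \<Longrightarrow> V = W"
  using net unfolding network_def by blast

lemma outputs_unique:
  "V \<in> nodes G \<Longrightarrow> W \<in> nodes G \<Longrightarrow> p \<in> outputs G V \<Longrightarrow> p \<in> outputs G W \<Longrightarrow> V = W"
  using net unfolding network_def by blast

lemma inputs_outputs_disjoint:
  "V \<in> nodes G \<Longrightarrow> W \<in> nodes G \<Longrightarrow> p \<in> inputs G V \<Longrightarrow> p \<notin> outputs G W"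
  using net unfolding network_def by blast

lemma edge_ports:
  assumes "(p, q) \<in> edges G"
  shows "p \<in> outs G (nodes G)" "q \<in> ins G (nodes G)"
  using net assms by (auto simp: network_def ins_def outs_def)

lemma ins_outs_disjoint:
  "X \<subseteq> nodes G \<Longrightarrow> Y \<subseteq> nodes G \<Longrightarrow> p \<in> ins G X \<Longrightarrow> p \<in> outs G Y \<Longrightarrow> False"
  unfolding ins_def outs_def by (blast dest: inputs_outputs_disjoint)

lemma ins_unique:
  "X \<subseteq> nodes G \<Longrightarrow> Y \<subseteq> nodes G \<Longrightarrow> X \<inter> Y = {} \<Longrightarrow> p \<in> ins G X \<Longrightarrow> p \<notin> ins G Y"
  unfolding ins_def by (blast dest: inputs_unique)

lemma outs_unique:
  "X \<subseteq> nodes G \<Longrightarrow> Y \<subseteq> nodes G \<Longrightarrow> X \<inter> Y = {} \<Longrightarrow> p \<in> outs G X \<Longrightarrow> p \<notin> outs G Y"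
  unfolding outs_def by (blast dest: outputs_unique)

section \<open>Entries of the columns of \<open>I - F\<close>\<close>

lemma coef_input:
  assumes "q \<in> ins G (nodes G)"
  shows "coef G \<beta> p q = (if (p, q) \<in> edges G then 1 else 0)"
  using assms unfolding coef_def ins_def by (auto dest: inputs_outputs_disjoint)

lemma coef_output:
  assumes "V \<in> nodes G" "q \<in> outputs G V"
  shows "coef G \<beta> p q = (if p \<in> inputs G V then \<beta> (p, q) else 0)"
proof -
  have "(p, q) \<notin> edges G"
    using edge_ports(2)[of p q] assms by (auto simp: ins_def dest: inputs_outputs_disjoint)
  moreover have "(\<exists>W\<in>nodes G. p \<in> inputs G W \<and> q \<in> outputs G W) \<longleftrightarrow> p \<in> inputs G V"
    using assms outputs_unique by blast
  ultimately show ?thesis by (simp add: coef_def)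
qed

text \<open>This is the shape of the modified vectors in \<open>generic_extension\<close>, with unit
  vectors for both \<open>w\<close> and \<open>e\<close>.\<close>

lemma col_output:
  assumes "V \<in> nodes G" "q \<in> outputs G V"
  shows "col_fun G \<beta> q = unit_fun q - (\<Sum>p\<in>inputs G V. fscale (\<beta> (p, q)) (unit_fun p))"
proof
  fix p
  have "(\<Sum>i\<in>inputs G V. \<beta> (i, q) * unit_fun i p)
      = (\<Sum>i\<in>inputs G V. if p = i then \<beta> (i, q) else 0)"
    by (intro sum.cong) (auto simp: unit_fun_apply)
  also have "\<dots> = (if p \<in> inputs G V then \<beta> (p, q) else 0)"
    using finite_inputs[OF assms(1)] by simp
  finally show "col_fun G \<beta> q p
      = (unit_fun q - (\<Sum>p\<in>inputs G V. fscale (\<beta> (p, q)) (unit_fun p))) p"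
    by (simp add: col_fun_def coef_output[OF assms] sum_fun_apply fscale_apply)
qed

text \<open>Edges start at outputs, so the block of \<open>I - F\<close> on the inputs is an
  identity matrix.\<close>

lemma col_input_at_input:
  assumes "q \<in> ins G (nodes G)" "p \<in> ins G (nodes G)"
  shows "col_fun G \<beta> q p = (if p = q then 1 else 0)"
proof -
  have "(p, q) \<notin> edges G"
    using edge_ports(1)[of p q] assms(2) ins_outs_disjoint by blast
  then show ?thesis using assms by (simp add: col_fun_def coef_input unit_fun_apply)
qed

lemma col_output_at_input:
  assumes "X \<subseteq> nodes G" "V \<in> nodes G" "V \<notin> X" "q \<in> outs G X" "p \<in> inputs G V"
  shows "col_fun G \<beta> q p = 0"
proof -
  obtain W where W: "W \<in> X" "q \<in> outputs G W" using assms(4) by (auto simp: outs_def)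
  have "p \<notin> inputs G W" using assms W inputs_unique[of V W p] by blast
  moreover have "p \<noteq> q" using inputs_outputs_disjoint[of V W p] assms W by blast
  ultimately show ?thesis
    using W assms(1) by (auto simp: col_fun_def coef_output unit_fun_apply)
qed

lemma finite_gens:
  "U \<subseteq> nodes G \<Longrightarrow> \<Omega> \<subseteq> nodes G \<Longrightarrow> W \<subseteq> nodes G \<Longrightarrow> finite (gens G \<beta> U \<Omega> W)"
  by (simp add: gens_def finite_ins finite_outs)

text \<open>The invariant says that the rank of the submatrix belonging to a cut, minus the number
  of ports of \<open>U\<close>, is at least \<open>m - card (ports G)\<close>. Only the columns of
  the outputs of \<open>V\<close> are chosen anew. For a cut \<Omega>, the cuts \<Omega> and
  \<open>insert V \<Omega>\<close> of the previous stage bound the two arguments of the minimum in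
  \<open>generic_extension\<close>.\<close>

lemma generic_elimination_step:
  fixes \<beta> :: "'p \<times> 'p \<Rightarrow> 'k::field"
  assumes inf: "infinite (UNIV :: 'k set)"
    and V: "V \<in> nodes G" "V \<notin> U" "V \<noteq> S" "V \<noteq> T" and U: "U \<subseteq> nodes G"
    and inv: "\<And>\<Omega>. \<Omega> \<subseteq> nodes G - U \<Longrightarrow> S \<in> \<Omega> \<Longrightarrow> T \<in> nodes G - U - \<Omega> \<Longrightarrow>
      m \<le> fv.dim (gens G \<beta> U \<Omega> (nodes G - U - \<Omega>)) + card (outs G \<Omega>)"
  obtains \<beta>' :: "'p \<times> 'p \<Rightarrow> 'k"
  where "\<And>\<Omega>. \<Omega> \<subseteq> nodes G - insert V U \<Longrightarrow> S \<in> \<Omega> \<Longrightarrow> T \<in> nodes G - insert V U - \<Omega> \<Longrightarrow>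
      m \<le> fv.dim (gens G \<beta>' (insert V U) \<Omega> (nodes G - insert V U - \<Omega>)) + card (outs G \<Omega>)"
proof -
  define rest where "rest \<Omega> = nodes G - insert V U - \<Omega>" for \<Omega>
  define cuts where "cuts = {\<Omega>. \<Omega> \<subseteq> nodes G - insert V U \<and> S \<in> \<Omega> \<and> T \<in> rest \<Omega>}"
  \<comment> \<open>The generators for \<open>insert V U\<close> except the columns of the outputs
    of \<open>V\<close>, which are the only ones to change.\<close>
  define A where "A \<Omega> = col_fun G \<beta> ` (ins G U \<union> outs G U \<union> inputs G V \<union> ins G (rest \<Omega>))
     \<union> unit_fun ` (ins G \<Omega> \<union> ins G (rest \<Omega>) \<union> outs G (rest \<Omega>))" for \<Omega>
  have sub: "\<Omega> \<subseteq> nodes G" "rest \<Omega> \<subseteq> nodes G" if "\<Omega> \<in> cuts" for \<Omega>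
    using that by (auto simp: cuts_def rest_def)
  have finA: "finite (A \<Omega>)" if "\<Omega> \<in> cuts" for \<Omega>
    using sub[OF that] U V by (simp add: A_def finite_ins finite_outs finite_inputs)
  have "finite cuts"
    by (rule finite_subset[of _ "Pow (nodes G)"]) (auto simp: cuts_def finite_nodes)
  then obtain b where b: "\<forall>B\<in>A ` cuts. min (fv.dim B + card (outputs G V))
        (fv.dim (B \<union> unit_fun ` inputs G V \<union> unit_fun ` outputs G V))
      \<le> fv.dim (B \<union> (\<lambda>q. unit_fun q - (\<Sum>p\<in>inputs G V. fscale (b (p, q)) (unit_fun p)))
          ` outputs G V)"
    using fv.generic_extension[OF inf finite_outputs[OF V(1)] finite_inputs[OF V(1)],
        of "A ` cuts" unit_fun unit_fun] finA by blast
  define \<beta>' where "\<beta>' = (\<lambda>(p, q). if q \<in> outputs G V then b (p, q) else \<beta> (p, q))"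
  have new: "col_fun G \<beta>' ` outputs G V
      = (\<lambda>q. unit_fun q - (\<Sum>p\<in>inputs G V. fscale (b (p, q)) (unit_fun p))) ` outputs G V"
    by (intro image_cong refl) (simp add: col_output[OF V(1)] \<beta>'_def)
  have old: "col_fun G \<beta>' q = col_fun G \<beta> q" if "q \<notin> outputs G V" for q
    using that by (intro col_cong) (simp add: \<beta>'_def)
  show thesis
  proof (rule that[of \<beta>'])
    fix \<Omega> assume \<Omega>: "\<Omega> \<subseteq> nodes G - insert V U" "S \<in> \<Omega>" "T \<in> nodes G - insert V U - \<Omega>"
    then have cut: "\<Omega> \<in> cuts" by (simp add: cuts_def rest_def)
    note sub = sub[OF cut]
    have VW: "V \<notin> \<Omega>" "V \<notin> rest \<Omega>" "V \<notin> U" using \<Omega> V by (auto simp: rest_def)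
    have outV: "p \<notin> outputs G V" if "p \<in> ins G X \<or> p \<in> outs G Y \<or> p \<in> inputs G V"
      "X \<subseteq> nodes G" "Y \<subseteq> nodes G" "V \<notin> Y" for p X Y
      using that(1)
    proof (elim disjE)
      show ?thesis if "p \<in> ins G X"
        using ins_outs_disjoint[of X "{V}" p] V(1) that \<open>X \<subseteq> nodes G\<close> by simp blast
      show ?thesis if "p \<in> outs G Y"
        using outs_unique[of Y "{V}" p] V(1) that \<open>Y \<subseteq> nodes G\<close> \<open>V \<notin> Y\<close> by simp
      show ?thesis if "p \<in> inputs G V"
        using inputs_outputs_disjoint[of V V p] V(1) that by simp
    qed
    have gens': "gens G \<beta>' (insert V U) \<Omega> (rest \<Omega>) = A \<Omega> \<union> col_fun G \<beta>' ` outputs G V"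
    proof -
      have "col_fun G \<beta>' ` (ins G U \<union> outs G U \<union> inputs G V \<union> ins G (rest \<Omega>))
          = col_fun G \<beta> ` (ins G U \<union> outs G U \<union> inputs G V \<union> ins G (rest \<Omega>))"
      proof (intro image_cong refl old)
        fix q assume "q \<in> ins G U \<union> outs G U \<union> inputs G V \<union> ins G (rest \<Omega>)"
        then show "q \<notin> outputs G V"
          using outV[of q "U \<union> rest \<Omega>" U] U sub VW by (auto simp: ins_def)
      qed
      then have "A \<Omega> = col_fun G \<beta>' ` (ins G U \<union> outs G U \<union> inputs G V \<union> ins G (rest \<Omega>))
          \<union> unit_fun ` (ins G \<Omega> \<union> ins G (rest \<Omega>) \<union> outs G (rest \<Omega>))"
        by (simp only: A_def)
      then show ?thesis by (simp only: gens_def ins_insert outs_insert image_Un Un_ac)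
    qed
    \<comment> \<open>The previous stage with \<open>V\<close> on the side of \<open>T\<close>: the
      rows of all its ports are deleted.\<close>
    have m1: "m \<le> fv.dim (A \<Omega> \<union> unit_fun ` inputs G V \<union> unit_fun ` outputs G V)
        + card (outs G \<Omega>)"
    proof -
      have "nodes G - U - \<Omega> = insert V (rest \<Omega>)" using V \<Omega> by (auto simp: rest_def)
      then have "m \<le> fv.dim (gens G \<beta> U \<Omega> (insert V (rest \<Omega>))) + card (outs G \<Omega>)"
        using inv[of \<Omega>] \<Omega> by auto
      moreover have "gens G \<beta> U \<Omega> (insert V (rest \<Omega>))
          = A \<Omega> \<union> unit_fun ` inputs G V \<union> unit_fun ` outputs G V"
        by (simp only: gens_def A_def ins_insert outs_insert image_Un Un_ac)
      ultimately show ?thesis by simp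
    qed
    \<comment> \<open>The previous stage with \<open>V\<close> on the side of \<open>S\<close>: its
      outputs are remaining rows and are counted by \<open>card\<close>, while only its input rows
      are deleted.\<close>
    have m2: "m \<le> fv.dim (A \<Omega>) + card (outputs G V) + card (outs G \<Omega>)"
    proof -
      define B where "B = col_fun G \<beta> ` (ins G U \<union> outs G U \<union> ins G (rest \<Omega>))
        \<union> unit_fun ` (ins G \<Omega> \<union> ins G (rest \<Omega>) \<union> outs G (rest \<Omega>))"
      have eq: "nodes G - U - insert V \<Omega> = rest \<Omega>" by (auto simp: rest_def)
      have "m \<le> fv.dim (gens G \<beta> U (insert V \<Omega>) (rest \<Omega>)) + card (outs G (insert V \<Omega>))"
        using inv[of "insert V \<Omega>"] \<Omega> V unfolding eq by (auto simp: rest_def)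
      also have "gens G \<beta> U (insert V \<Omega>) (rest \<Omega>) = B \<union> unit_fun ` inputs G V"
        by (simp only: gens_def B_def ins_insert outs_insert image_Un Un_ac)
      also have "card (outs G (insert V \<Omega>)) = card (outputs G V) + card (outs G \<Omega>)"
        using outV[of _ "{}" \<Omega>] sub VW V(1)
        by (simp, intro card_Un_disjoint finite_outputs finite_outs) auto
      \<comment> \<open>All of \<open>B\<close> vanishes at the inputs of \<open>V\<close>, where
        the columns of these inputs form an identity block.\<close>
      also have "fv.dim (B \<union> unit_fun ` inputs G V) \<le> fv.dim (B \<union> col_fun G \<beta> ` inputs G V)"
      proof (rule dim_Un_unit_coordinates_replace)
        show "finite B" using sub U V by (simp add: B_def finite_ins finite_outs)
        show "finite (inputs G V)" using V(1) by (rule finite_inputs)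
        have nin: "p \<in> ins G (nodes G)" if "p \<in> inputs G V" for p
          using that V(1) by (auto simp: ins_def)
        show "col_fun G \<beta> c' c = (if c = c' then 1 else 0)"
          if "c \<in> inputs G V" "c' \<in> inputs G V" for c c'
          using that by (simp add: col_input_at_input nin)
        fix v c assume v: "v \<in> B" and c: "c \<in> inputs G V"
        have cX: "c \<notin> ins G X" "c \<notin> outs G X" if "X \<subseteq> nodes G" "V \<notin> X" for X
          using that V(1) c ins_unique[of X "{V}" c] ins_outs_disjoint[of "{V}" X c] by auto
        have insX: "col_fun G \<beta> q c = 0" if "q \<in> ins G X" "X \<subseteq> nodes G" "V \<notin> X" for q X
        proof -
          have "q \<in> ins G (nodes G)" "q \<noteq> c" using that cX(1)[OF that(2,3)] by (auto simp: ins_def)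
          then show ?thesis using nin[OF c] by (simp add: col_input_at_input)
        qed
        from v show "v c = 0"
          unfolding B_def
          using insX[of _ U] insX[of _ "rest \<Omega>"] col_output_at_input[OF U V(1,2) _ c]
            cX[of \<Omega>] cX[of "rest \<Omega>"] sub U VW by (auto simp: unit_fun_apply)
      qed
      also have "B \<union> col_fun G \<beta> ` inputs G V = A \<Omega>"
        by (simp only: A_def B_def image_Un Un_ac)
      finally show ?thesis by simp
    qed
    have "min (fv.dim (A \<Omega>) + card (outputs G V))
        (fv.dim (A \<Omega> \<union> unit_fun ` inputs G V \<union> unit_fun ` outputs G V))
      \<le> fv.dim (gens G \<beta>' (insert V U) \<Omega> (rest \<Omega>))"
      unfolding gens' new using b cut by blast
    then show "m \<le> fv.dim (gens G \<beta>' (insert V U) \<Omega> (nodes G - insert V U - \<Omega>)) + card (outs G \<Omega>)"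
      using m1 m2 unfolding rest_def by linarith
  qed
qed

text \<open>For \<open>U = {}\<close> only columns of input ports occur. These contain no
  coefficients, so the initial bound can be stated with all coefficients 0.\<close>

lemma generic_elimination:
  assumes inf: "infinite (UNIV :: 'k::field set)"
    and U: "U \<subseteq> nodes G - {S, T}"
    and init: "\<And>\<Omega>. \<Omega> \<subseteq> nodes G \<Longrightarrow> S \<in> \<Omega> \<Longrightarrow> T \<in> nodes G - \<Omega> \<Longrightarrow>
      m \<le> fv.dim (gens G (\<lambda>_. 0 :: 'k) {} \<Omega> (nodes G - \<Omega>)) + card (outs G \<Omega>)"
  shows "\<exists>\<beta> :: 'p \<times> 'p \<Rightarrow> 'k. \<forall>\<Omega>. \<Omega> \<subseteq> nodes G - U \<longrightarrow> S \<in> \<Omega> \<longrightarrow> T \<in> nodes G - U - \<Omega> \<longrightarrow>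
      m \<le> fv.dim (gens G \<beta> U \<Omega> (nodes G - U - \<Omega>)) + card (outs G \<Omega>)"
proof -
  have "finite U" using U finite_nodes finite_subset by blast
  then show ?thesis using U
  proof induction
    case empty
    show ?case using init by (intro exI[of _ "\<lambda>_. 0"]) simp
  next
    case (insert V U)
    then obtain \<beta> :: "'p \<times> 'p \<Rightarrow> 'k" where
      \<beta>: "\<And>\<Omega>. \<Omega> \<subseteq> nodes G - U \<Longrightarrow> S \<in> \<Omega> \<Longrightarrow> T \<in> nodes G - U - \<Omega> \<Longrightarrow>
        m \<le> fv.dim (gens G \<beta> U \<Omega> (nodes G - U - \<Omega>)) + card (outs G \<Omega>)" by blast
    show ?case
      by (rule generic_elimination_step[OF inf _ _ _ _ _ \<beta>, of V]) (use insert in auto)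
  qed
qed

end

subsection \<open>From the field of rational functions back to the given field\<close>

text \<open>Each coefficient shifts a single column along a fixed direction, so by
  \<open>dim_insert_zero_one\<close> it can be replaced by 0 or 1 without loss. Induction over a
  finite set of pairs treats them one by one.\<close>

lemma zero_one_coefficients:
  fixes G :: "('v, 'p) network" and \<beta> :: "'p \<times> 'p \<Rightarrow> 'k::field"
  assumes G: "network G" and X: "finite X" and Z: "finite Z"
  obtains \<beta>' :: "'p \<times> 'p \<Rightarrow> 'k" where "\<And>x. \<beta>' x \<in> {0, 1}"
    and "fv.dim (col_fun G \<beta> ` X \<union> Z) \<le> fv.dim (col_fun G \<beta>' ` X \<union> Z)"
proof -
  have "\<exists>\<beta>' :: 'p \<times> 'p \<Rightarrow> 'k. (\<forall>x\<in>D. \<beta>' x \<in> {0, 1}) \<and>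
      fv.dim (col_fun G \<beta> ` X \<union> Z) \<le> fv.dim (col_fun G \<beta>' ` X \<union> Z)" if "finite D" for D
    using that
  proof induction
    case empty
    show ?case by (intro exI[of _ \<beta>]) simp
  next
    case (insert x D)
    then obtain \<gamma> :: "'p \<times> 'p \<Rightarrow> 'k" where \<gamma>: "\<forall>x\<in>D. \<gamma> x \<in> {0, 1}"
      "fv.dim (col_fun G \<beta> ` X \<union> Z) \<le> fv.dim (col_fun G \<gamma> ` X \<union> Z)" by blast
    obtain p q where x: "x = (p, q)" by force
    define w where "w = col_fun G (\<gamma>(x := 0)) q"
    \<comment> \<open>The direction in which the column of \<open>q\<close> moves; it is 0 if the
      pair carries no coefficient.\<close>
    define e :: "'p \<Rightarrow> 'k" where "e = (if (p, q) \<notin> edges G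
      \<and> (\<exists>V\<in>nodes G. p \<in> inputs G V \<and> q \<in> outputs G V) then unit_fun p else 0)"
    have other: "col_fun G (\<gamma>(x := t)) r = col_fun G \<gamma> r" if "r \<noteq> q" for t r
      using that x by (intro col_cong) simp
    have col_q: "col_fun G (\<gamma>(x := t)) q = w - fscale t e" for t
      by (auto simp: w_def e_def x col_fun_def coef_def fscale_apply unit_fun_apply fun_eq_iff)
    have img: "col_fun G (\<gamma>(x := t)) ` X \<union> Z =
        (if q \<in> X then insert (w - fscale t e) (col_fun G \<gamma> ` (X - {q}) \<union> Z)
         else col_fun G \<gamma> ` X \<union> Z)" for t
    proof (cases "q \<in> X")
      case True
      have "col_fun G (\<gamma>(x := t)) ` (X - {q}) = col_fun G \<gamma> ` (X - {q})"
        by (intro image_cong refl other) blast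
      then have "col_fun G (\<gamma>(x := t)) ` insert q (X - {q})
          = insert (w - fscale t e) (col_fun G \<gamma> ` (X - {q}))"
        by (simp only: image_insert col_q)
      then show ?thesis using True by (simp add: insert_absorb)
    next
      case False
      then have "col_fun G (\<gamma>(x := t)) ` X = col_fun G \<gamma> ` X"
        by (intro image_cong refl other) blast
      then show ?thesis using False by simp
    qed
    have "\<exists>t\<in>{0, 1}. fv.dim (col_fun G \<gamma> ` X \<union> Z) \<le> fv.dim (col_fun G (\<gamma>(x := t)) ` X \<union> Z)"
    proof (cases "q \<in> X")
      case True
      have "finite (col_fun G \<gamma> ` (X - {q}) \<union> Z)" using X Z by simp
      from fv.dim_insert_zero_one[OF this, of w "\<gamma> x" e]
      show ?thesis using True img[of "\<gamma> x"] img[of 0] img[of 1] by (simp add: max_def split: if_splits)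
    next
      case False
      then show ?thesis using img by auto
    qed
    then obtain t where "t \<in> {0, 1}"
      "fv.dim (col_fun G \<gamma> ` X \<union> Z) \<le> fv.dim (col_fun G (\<gamma>(x := t)) ` X \<union> Z)" by blast
    moreover from this(1) have "\<forall>y\<in>insert x D. (\<gamma>(x := t)) y \<in> {0, 1}" using \<gamma>(1) by auto
    ultimately show ?case using \<gamma>(2) order_trans by blast
  qed
  from this[of "ports G \<times> ports G"] finite_ports[OF G]
  obtain \<gamma> :: "'p \<times> 'p \<Rightarrow> 'k" where \<gamma>: "\<forall>x\<in>ports G \<times> ports G. \<gamma> x \<in> {0, 1}"
    "fv.dim (col_fun G \<beta> ` X \<union> Z) \<le> fv.dim (col_fun G \<gamma> ` X \<union> Z)" by blast
  \<comment> \<open>No column depends on the values off the pairs of ports; the value 0 there gives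
    the claim for all pairs, even if the type of ports is infinite.\<close>
  define \<beta>' where "\<beta>' x = (if x \<in> ports G \<times> ports G then \<gamma> x else 0)" for x
  have "coef G \<beta>' p q = coef G \<gamma> p q" for p q
    by (auto simp: coef_def \<beta>'_def ports_def)
  then have "col_fun G \<beta>' = col_fun G \<gamma>" by (simp add: col_fun_def fun_eq_iff)
  then show thesis using \<gamma> by (intro that[of \<beta>']) (auto simp: \<beta>'_def)
qed

section \<open>Dimensions under a field homomorphism\<close>

lemma supported_in_span_units:
  fixes v :: "'p \<Rightarrow> 'k::field"
  assumes "finite P" "\<And>p. p \<notin> P \<Longrightarrow> v p = 0"
  shows "v \<in> fv.span (unit_fun ` P)"
proof -
  have "v = (\<Sum>p\<in>P. fscale (v p) (unit_fun p))"
  proof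
    fix q
    have "(\<Sum>p\<in>P. v p * unit_fun p q) = (\<Sum>p\<in>P. if q = p then v p else 0)"
      by (intro sum.cong) (auto simp: unit_fun_apply)
    then show "v q = (\<Sum>p\<in>P. fscale (v p) (unit_fun p)) q"
      using assms by (simp add: sum_fun_apply fscale_apply)
  qed
  also have "\<dots> \<in> fv.span (unit_fun ` P)"
    by (intro fv.span_sum fv.span_scale fv.span_base) blast
  finally show ?thesis .
qed

lemma dim_units: "finite P \<Longrightarrow> fv.dim (unit_fun ` P :: ('p \<Rightarrow> 'k::field) set) = card P"
  using dim_Un_unit_coordinates[of "{}" P "unit_fun :: 'p \<Rightarrow> 'p \<Rightarrow> 'k"]
    fv.dim_le_card'[of "unit_fun ` P :: ('p \<Rightarrow> 'k) set"] card_image_le[of P "unit_fun :: 'p \<Rightarrow> 'p \<Rightarrow> 'k"]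
  by (auto simp: unit_fun_apply)

context field_hom
begin

lemma comp_in_span:
  assumes "v \<in> fv.span B"
  shows "hom \<circ> v \<in> fv.span ((\<circ>) hom ` B)"
  using assms
proof (induction rule: fv.span_induct_alt)
  case base
  have "hom \<circ> (0 :: 'c \<Rightarrow> 'a) = 0" by (simp add: fun_eq_iff)
  then show ?case using fv.span_zero by metis
next
  case (step c x y)
  have "hom \<circ> (fscale c x + y) = fscale (hom c) (hom \<circ> x) + (hom \<circ> y)"
    by (simp add: fun_eq_iff fscale_apply hom_add hom_mult)
  also have "\<dots> \<in> fv.span ((\<circ>) hom ` B)"
    using imageI[OF step.hyps, of "(\<circ>) hom"] step.IH
    by (rule fv.span_add[OF fv.span_scale[OF fv.span_base]])
  finally show ?case .
qed

text \<open>A basis is mapped to a spanning set of the image.\<close>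

lemma dim_comp_le:
  assumes "finite W"
  shows "fv.dim ((\<circ>) hom ` W) \<le> fv.dim W"
proof -
  obtain B where B: "B \<subseteq> W" "fv.independent B" "W \<subseteq> fv.span B" "card B = fv.dim W"
    using fv.basis_exists .
  have fin: "finite B" using B(1) assms finite_subset by blast
  have "(\<circ>) hom ` W \<subseteq> fv.span ((\<circ>) hom ` B)" using B(3) comp_in_span by blast
  then have "fv.dim ((\<circ>) hom ` W) \<le> card ((\<circ>) hom ` B)" using fin by (intro fv.dim_le_card) auto
  also have "\<dots> \<le> card B" using fin by (rule card_image_le)
  finally show ?thesis using B(4) by simp
qed

lemma comp_unit_fun: "hom \<circ> unit_fun p = unit_fun p"
  by (simp add: fun_eq_iff unit_fun_apply)

text \<open>A basis completed by unit vectors spans all of them, also after extending the field.\<close>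

lemma dim_comp_ge:
  fixes W :: "('p \<Rightarrow> 'a) set"
  assumes W: "finite W" and P: "finite P" and supp: "\<And>v p. v \<in> W \<Longrightarrow> p \<notin> P \<Longrightarrow> v p = 0"
  shows "fv.dim W \<le> fv.dim ((\<circ>) hom ` W)"
proof -
  obtain B where B: "B \<subseteq> W" "fv.independent B" "W \<subseteq> fv.span B" "card B = fv.dim W"
    using fv.basis_exists .
  have finB: "finite B" using B(1) W finite_subset by blast
  obtain C where C: "B \<subseteq> C" "C \<subseteq> B \<union> unit_fun ` P" "fv.independent C"
    "B \<union> unit_fun ` P \<subseteq> fv.span C"
    using fv.maximal_independent_subset_extend[of B "B \<union> unit_fun ` P"] B(2) by blast
  have finC: "finite C" using C(2) finB P finite_subset by blast
  have "B \<union> unit_fun ` P \<subseteq> fv.span (unit_fun ` P)"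
    using supported_in_span_units[OF P] supp B(1) by (auto intro: fv.span_base)
  then have "C \<subseteq> fv.span (unit_fun ` P)" using C(2) by blast
  then have "card C \<le> fv.dim (unit_fun ` P :: ('p \<Rightarrow> 'a) set)"
    using P C(3) by (intro fv.independent_card_le_dim_finite(2)) auto
  then have "card C \<le> card P" using P by (simp add: dim_units)
  also have "card P = fv.dim (unit_fun ` P :: ('p \<Rightarrow> 'b) set)" using P by (simp add: dim_units)
  also have "\<dots> \<le> fv.dim ((\<circ>) hom ` C)"
  proof (rule fv.dim_mono_finite)
    show "finite ((\<circ>) hom ` C)" using finC by simp
    have "unit_fun p \<in> fv.span ((\<circ>) hom ` C)" if "p \<in> P" for p
    proof -
      have "unit_fun p \<in> fv.span C" using C(4) that by blast
      from comp_in_span[OF this] show ?thesis unfolding comp_unit_fun .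
    qed
    then show "unit_fun ` P \<subseteq> fv.span ((\<circ>) hom ` C)" by blast
  qed
  \<comment> \<open>Removing the completing vectors costs at most \<open>card (C - B)\<close>, so
    the image of \<open>B\<close> keeps dimension at least \<open>card B\<close>.\<close>
  also have "\<dots> = fv.dim ((\<circ>) hom ` B \<union> (\<circ>) hom ` (C - B))"
    using C(1) by (simp add: image_Un[symmetric] Un_absorb1)
  also have "\<dots> \<le> fv.dim ((\<circ>) hom ` B) + card ((\<circ>) hom ` (C - B))"
    using finB finC by (intro fv.dim_Un_le) auto
  also have "\<dots> \<le> fv.dim ((\<circ>) hom ` W) + card (C - B)"
    using finC W B(1) by (intro add_mono card_image_le fv.dim_mono_finite subset_trans[OF _ fv.span_superset]) auto
  finally have "card C \<le> fv.dim ((\<circ>) hom ` W) + card (C - B)" .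
  moreover have "card C = card B + card (C - B)"
    using C(1) finC finB by (metis card_Diff_subset card_mono le_add_diff_inverse)
  ultimately show ?thesis using B(4) by simp
qed

lemma comp_col_fun: "hom \<circ> col_fun G \<beta> q = col_fun G (hom \<circ> \<beta>) q"
proof -
  have "coef G (hom \<circ> \<beta>) p q = hom (coef G \<beta> p q)" for p by (auto simp: coef_def)
  then show ?thesis by (simp add: fun_eq_iff col_fun_def unit_fun_apply hom_minus)
qed

lemma comp_gens: "(\<circ>) hom ` gens G \<beta> U \<Omega> W = gens G (hom \<circ> \<beta>) U \<Omega> W"
  by (simp only: gens_def image_Un image_image comp_col_fun comp_unit_fun)

end

text \<open>Supplies the finite support that \<open>dim_comp_ge\<close> asks for.\<close>

lemma gens_supported:
  fixes v :: "'p \<Rightarrow> 'k::field"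
  assumes G: "network G" and sub: "U \<subseteq> nodes G" "\<Omega> \<subseteq> nodes G" "W \<subseteq> nodes G"
    and v: "v \<in> gens G \<beta> U \<Omega> W" and p: "p \<notin> ports G"
  shows "v p = 0"
proof -
  have "coef G \<beta> p q = 0" for q
    using edge_ports(1)[OF G, of p q] p by (auto simp: coef_def ports_def outs_def)
  then have zero: "col_fun G \<beta> q p = 0" "unit_fun q p = (0 :: 'k)" if "q \<in> ports G" for q
    using that p by (auto simp: col_fun_def unit_fun_apply)
  have sub': "q \<in> ports G" if "q \<in> ins G X \<or> q \<in> outs G X" "X \<subseteq> nodes G" for X q
    using that by (auto simp: ins_def outs_def ports_def)
  have "\<exists>q\<in>ports G. v = col_fun G \<beta> q \<or> v = unit_fun q"
    using v sub'[of _ U] sub'[of _ \<Omega>] sub'[of _ W] sub unfolding gens_def by blast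
  then show ?thesis using zero by auto
qed

text \<open>The bounds are lifted to an infinite field by \<open>dim_comp_ge\<close>, all nodes but
  \<open>S\<close> and \<open>T\<close> are eliminated there, and the coefficients are replaced by 0
  and 1. These come from the original field, where by \<open>dim_comp_le\<close> the dimension is at
  least as large.\<close>

lemma coefficients_exist:
  fixes G :: "('v, 'p) network"
  assumes G: "network G" and ST: "S \<in> nodes G" "T \<in> nodes G" "S \<noteq> T"
    and init: "\<And>\<Omega>. is_cut G S T \<Omega> \<Longrightarrow>
      m \<le> fv.dim (gens G (\<lambda>_. 0 :: 'a::field) {} \<Omega> (nodes G - \<Omega>)) + card (outs G \<Omega>)"
  obtains \<beta> :: "'p \<times> 'p \<Rightarrow> 'a::field"
  where "m \<le> fv.dim (gens G \<beta> (nodes G - {S, T}) {S} {T}) + card (outputs G S)"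
proof -
  define U where "U = nodes G - {S, T}"
  have sub: "U \<subseteq> nodes G" "{S} \<subseteq> nodes G" "{T} \<subseteq> nodes G" using ST by (auto simp: U_def)
  \<comment> \<open>The embedding of the constants into the rational functions, a field that is
    infinite because it contains all powers of the variable.\<close>
  define h :: "'a \<Rightarrow> 'a poly fract" where "h c = to_fract [:c:]" for c
  interpret h: field_hom h
    by unfold_locales (simp_all add: h_def flip: one_pCons to_fract_add to_fract_mult)
  have "inj (\<lambda>n. to_fract (monom 1 n :: 'a poly))"
    by (auto intro!: injI simp: monom_eq_iff')
  then have inf: "infinite (UNIV :: 'a poly fract set)"
    by (rule infinite_super[OF subset_UNIV range_inj_infinite])
  have "\<exists>\<beta> :: 'p \<times> 'p \<Rightarrow> 'a poly fract. \<forall>\<Omega>. \<Omega> \<subseteq> nodes G - U \<longrightarrow> S \<in> \<Omega> \<longrightarrow> T \<in> nodes G - U - \<Omega> \<longrightarrow>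
      m \<le> fv.dim (gens G \<beta> U \<Omega> (nodes G - U - \<Omega>)) + card (outs G \<Omega>)"
  proof (rule generic_elimination[OF G inf])
    fix \<Omega> assume \<Omega>: "\<Omega> \<subseteq> nodes G" "S \<in> \<Omega>" "T \<in> nodes G - \<Omega>"
    have "h \<circ> (\<lambda>_. 0) = (\<lambda>_ :: 'p \<times> 'p. 0)" by (simp add: fun_eq_iff)
    then have eq: "gens G (\<lambda>_. 0) {} \<Omega> (nodes G - \<Omega>)
        = (\<circ>) h ` gens G (\<lambda>_. 0) {} \<Omega> (nodes G - \<Omega>)"
      by (simp add: h.comp_gens)
    have "m \<le> fv.dim (gens G (\<lambda>_. 0 :: 'a) {} \<Omega> (nodes G - \<Omega>)) + card (outs G \<Omega>)"
      using \<Omega> by (intro init) (simp add: is_cut_def)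
    also have "fv.dim (gens G (\<lambda>_. 0 :: 'a) {} \<Omega> (nodes G - \<Omega>))
        \<le> fv.dim ((\<circ>) h ` gens G (\<lambda>_. 0) {} \<Omega> (nodes G - \<Omega>))"
      using \<Omega> by (intro h.dim_comp_ge[OF _ finite_ports[OF G]] finite_gens[OF G]
        gens_supported[OF G]) auto
    finally show "m \<le> fv.dim (gens G (\<lambda>_. 0 :: 'a poly fract) {} \<Omega> (nodes G - \<Omega>)) + card (outs G \<Omega>)"
      using eq by simp
  qed (simp add: U_def)
  \<comment> \<open>Only the cut \<open>{S}\<close> is left at this stage.\<close>
  moreover have "nodes G - U - {S} = {T}" "nodes G - U = {S, T}" using ST by (auto simp: U_def)
  ultimately obtain \<gamma> :: "'p \<times> 'p \<Rightarrow> 'a poly fract"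
    where \<gamma>: "m \<le> fv.dim (gens G \<gamma> U {S} {T}) + card (outs G {S})"
    using ST by (auto dest: spec[of _ "{S}"])
  have "finite (ins G U \<union> outs G U \<union> ins G {T})"
    "finite (unit_fun ` (ins G {S} \<union> ins G {T} \<union> outs G {T}) :: ('p \<Rightarrow> 'a poly fract) set)"
    using finite_ins[OF G] finite_outs[OF G] sub by (intro finite_UnI finite_imageI; blast)+
  then obtain \<gamma>' :: "'p \<times> 'p \<Rightarrow> 'a poly fract" where \<gamma>': "\<And>x. \<gamma>' x \<in> {0, 1}"
    "fv.dim (gens G \<gamma> U {S} {T}) \<le> fv.dim (gens G \<gamma>' U {S} {T})"
    unfolding gens_def using zero_one_coefficients[OF G] by metis
  define \<beta> :: "'p \<times> 'p \<Rightarrow> 'a" where "\<beta> x = (if \<gamma>' x = 0 then 0 else 1)" for x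
  have "h \<circ> \<beta> = \<gamma>'" using \<gamma>'(1) by (fastforce simp: \<beta>_def fun_eq_iff)
  then have "fv.dim (gens G \<gamma>' U {S} {T}) \<le> fv.dim (gens G \<beta> U {S} {T})"
    using h.dim_comp_le[OF finite_gens[OF G sub], of \<beta>] by (simp add: h.comp_gens)
  then show thesis using that[of \<beta>] \<gamma> \<gamma>'(2) by (simp add: U_def)
qed

subsection \<open>Matrix ranks as dimensions of function spaces\<close>

text \<open>Extension by zero of a vector whose entry \<open>i\<close> belongs to
  \<open>ps ! i\<close>. It carries the linear algebra of \<open>vec\<close> over to functions on
  ports.\<close>

definition port_fun :: "'p list \<Rightarrow> 'k::field vec \<Rightarrow> 'p \<Rightarrow> 'k" where
  "port_fun ps v = (\<Sum>i<length ps. fscale (v $ i) (unit_fun (ps ! i)))"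

lemma port_fun_nth:
  assumes "distinct ps" "i < length ps"
  shows "port_fun ps v (ps ! i) = v $ i"
proof -
  have "port_fun ps v (ps ! i) = (\<Sum>j<length ps. if i = j then v $ j else 0)"
    unfolding port_fun_def sum_fun_apply
    using assms by (intro sum.cong) (auto simp: fscale_apply unit_fun_apply nth_eq_iff_index_eq)
  then show ?thesis using assms(2) by simp
qed

lemma port_fun_outside: "p \<notin> set ps \<Longrightarrow> port_fun ps v p = 0"
  unfolding port_fun_def sum_fun_apply
  by (intro sum.neutral) (auto simp: fscale_apply unit_fun_apply)

lemma port_fun_eqI:
  assumes "distinct ps" "\<And>i. i < length ps \<Longrightarrow> f (ps ! i) = v $ i" "\<And>p. p \<notin> set ps \<Longrightarrow> f p = 0"
  shows "port_fun ps v = f"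
proof
  fix p show "port_fun ps v p = f p"
    using assms port_fun_nth[OF assms(1)] port_fun_outside[of p ps v]
    by (cases "p \<in> set ps") (auto simp: in_set_conv_nth)
qed

lemma inj_on_port_fun:
  assumes "distinct ps"
  shows "inj_on (port_fun ps) (carrier_vec (length ps))"
proof (intro inj_onI eq_vecI)
  fix v w i assume "v \<in> carrier_vec (length ps)" "w \<in> carrier_vec (length ps)"
    "port_fun ps v = port_fun ps w" "i < dim_vec w"
  then show "v $ i = w $ i" using port_fun_nth[OF assms] by (metis carrier_vecD)
qed auto

text \<open>On vectors of length \<open>n\<close> the map \<open>port_fun ps\<close> is linear and
  injective, so nontrivial relations transfer in both directions.\<close>

lemma (in vec_space) lin_dep_iff_dependent_port_fun:
  fixes ps :: "'p list"
  assumes ps: "distinct ps" "length ps = n" and B: "B \<subseteq> carrier_vec n" "finite B"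
  shows "lin_dep B \<longleftrightarrow> fv.dependent (port_fun ps ` B)"
proof -
  have inj: "inj_on (port_fun ps) B"
    using inj_on_port_fun[OF ps(1)] B(1) ps(2) inj_on_subset by blast
  have lin: "(\<Sum>v\<in>B. fscale (a v) (port_fun ps v)) = port_fun ps (lincomb a B)" for a
  proof (rule sym, rule port_fun_eqI[OF ps(1)])
    show "(\<Sum>v\<in>B. fscale (a v) (port_fun ps v)) (ps ! i) = lincomb a B $ i"
      if "i < length ps" for i
      using that ps B by (simp add: sum_fun_apply fscale_apply port_fun_nth lincomb_index)
  qed (simp add: sum_fun_apply fscale_apply port_fun_outside)
  have zero: "port_fun ps v = 0 \<longleftrightarrow> v = 0\<^sub>v n" if "v \<in> carrier_vec n" for v
  proof -
    have "port_fun ps (0\<^sub>v n) = 0" using ps by (intro port_fun_eqI) auto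
    then show ?thesis
      using inj_on_port_fun[OF ps(1)] ps(2) that by (metis inj_on_def zero_carrier_vec)
  qed
  show ?thesis
  proof
    assume "lin_dep B"
    then obtain a v where a: "lincomb a B = 0\<^sub>v n" "v \<in> B" "a v \<noteq> 0"
      using finite_lin_dep[OF B(2)] B(1) by auto
    then have "(\<Sum>v\<in>B. fscale (a v) (port_fun ps v)) = 0"
      using lin zero[OF zero_carrier_vec] by simp
    then have "(\<Sum>w\<in>port_fun ps ` B. fscale (a (the_inv_into B (port_fun ps) w)) w) = 0"
      using inj by (simp add: sum.reindex the_inv_into_f_f)
    moreover have "a (the_inv_into B (port_fun ps) (port_fun ps v)) \<noteq> 0"
      using a inj by (simp add: the_inv_into_f_f)
    ultimately show "fv.dependent (port_fun ps ` B)"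
      unfolding fv.dependent_explicit using a(2) B(2)
      by (intro exI[of _ "port_fun ps ` B"] exI[of _ "\<lambda>w. a (the_inv_into B (port_fun ps) w)"]) auto
  next
    assume "fv.dependent (port_fun ps ` B)"
    then obtain u w where u: "w \<in> port_fun ps ` B" "u w \<noteq> 0"
      "(\<Sum>w\<in>port_fun ps ` B. fscale (u w) w) = 0"
      using B(2) by (auto simp: fv.dependent_finite)
    then have "(\<Sum>v\<in>B. fscale ((u \<circ> port_fun ps) v) (port_fun ps v)) = 0"
      using inj by (simp add: sum.reindex)
    moreover have "lincomb (u \<circ> port_fun ps) B \<in> carrier_vec n"
      using B by (intro lincomb_closed) auto
    ultimately have lc: "lincomb (u \<circ> port_fun ps) B = 0\<^sub>v n" using lin zero by metis
    obtain v where v: "v \<in> B" "(u \<circ> port_fun ps) v \<noteq> 0" using u by auto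
    show "lin_dep B"
      by (rule lin_dep_crit[OF B(2) order_refl _ v(1) _ lc]) (use v(2) in auto)
  qed
qed

text \<open>A maximal independent set of columns has as many elements as the rank, and its image is
  a basis of the span of all images.\<close>

lemma mat_rank_eq_dim:
  fixes ps :: "'p list" and A :: "'k::field mat"
  assumes ps: "distinct ps" "length ps = dim_row A"
  shows "mat_rank A = fv.dim (port_fun ps ` set (cols A))"
proof -
  interpret vec_space "TYPE('k)" "dim_row A" .
  have cols: "set (cols A) \<subseteq> carrier_vec (dim_row A)" by (rule cols_dim)
  have A: "A \<in> carrier_mat (dim_row A) (dim_col A)" by simp
  note dep = lin_dep_iff_dependent_port_fun[OF ps]
  have "lin_indpt {}" using dep[of "{}"] by (simp add: fv.independent_empty)
  then have "\<exists>B. finite B \<and> maximal B (\<lambda>X. X \<subseteq> set (cols A) \<and> lin_indpt X) \<and> {} \<subseteq> B"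
    by (intro maximal_exists_superset[of "set (cols A)"]) auto
  then obtain B where fin: "finite B" and max: "maximal B (\<lambda>X. X \<subseteq> set (cols A) \<and> lin_indpt X)"
    by blast
  have B: "B \<subseteq> set (cols A)" "lin_indpt B" using max by (auto simp: maximal_def)
  have BC: "B \<subseteq> carrier_vec (dim_row A)" using B(1) cols by blast
  have indep: "fv.independent (port_fun ps ` B)" using dep[OF BC fin] B(2) by blast
  have span: "port_fun ps v \<in> fv.span (port_fun ps ` B)" if v: "v \<in> set (cols A)" for v
  proof (cases "v \<in> B")
    case True
    then show ?thesis by (intro fv.span_base) blast
  next
    case False
    then have "lin_dep (insert v B)" using max v B(1) unfolding maximal_def by blast
    then have "fv.dependent (insert (port_fun ps v) (port_fun ps ` B))"
      using dep[of "insert v B"] BC fin subsetD[OF cols v] by simp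
    then show ?thesis using fv.independent_insertI[OF _ indep] by blast
  qed
  have "fv.dim (port_fun ps ` set (cols A)) = card (port_fun ps ` B)"
    using B(1) span indep by (intro fv.dim_unique) auto
  also have "\<dots> = card B"
    using inj_on_port_fun[OF ps(1)] BC ps(2) by (intro card_image) (auto intro: inj_on_subset)
  also have "\<dots> = mat_rank A" using rank_card_indpt[OF A max] by (simp add: mat_rank_def)
  finally show ?thesis by simp
qed

lemma mat_rank_mat_eq_dim:
  assumes "distinct ps"
  shows "mat_rank (mat (length ps) m f :: 'k::field mat)
    = fv.dim ((\<lambda>j. port_fun ps (vec (length ps) (\<lambda>i. f (i, j)))) ` {..<m})"
proof -
  have "set (cols (mat (length ps) m f)) = (\<lambda>j. vec (length ps) (\<lambda>i. f (i, j))) ` {..<m}"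
    by (auto simp: cols_def)
  then show ?thesis using mat_rank_eq_dim[OF assms, of "mat (length ps) m f"] by (simp add: image_image)
qed

text \<open>A basis among the \<open>x k\<close> is selected by a set of indices; by
  \<open>rel\<close>, the vectors \<open>y k\<close> at the same indices are independent
  too.\<close>

lemma dim_le_of_relations:
  fixes x :: "'i \<Rightarrow> 'p \<Rightarrow> 'k::field" and y :: "'i \<Rightarrow> 'q \<Rightarrow> 'k"
  assumes K: "finite K"
    and rel: "\<And>a. (\<Sum>k\<in>K. fscale (a k) (y k)) = 0 \<Longrightarrow> (\<Sum>k\<in>K. fscale (a k) (x k)) = 0"
  shows "fv.dim (x ` K) \<le> fv.dim (y ` K)"
proof -
  obtain B where B: "B \<subseteq> x ` K" "fv.independent B" "card B = fv.dim (x ` K)"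
    using fv.basis_exists[of "x ` K"] by metis
  obtain J where J: "J \<subseteq> K" "inj_on x J" "B = x ` J"
    using B(1) by (meson subset_image_inj)
  have finJ: "finite J" using J(1) K finite_subset by blast
  have "card J \<le> fv.dim (y ` K)"
  proof (rule fv.family_le_dim)
    show "y j \<in> fv.span (y ` K)" if "j \<in> J" for j
      using that J(1) by (intro fv.span_base) blast
    fix a :: "'i \<Rightarrow> 'k" assume a: "(\<Sum>j\<in>J. fscale (a j) (y j)) = 0"
    define b where "b k = (if k \<in> J then a k else 0)" for k
    have eq: "(\<Sum>k\<in>K. fscale (b k) (z k)) = (\<Sum>j\<in>J. fscale (a j) (z j))" for z :: "'i \<Rightarrow> 'r \<Rightarrow> 'k"
      using J(1) K by (intro sum.mono_neutral_cong_right) (auto simp: b_def)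
    have "(\<Sum>j\<in>J. fscale (a j) (x j)) = 0" using rel[of b] a eq[of x] eq[of y] by simp
    then have "(\<Sum>v\<in>x ` J. fscale (a (the_inv_into J x v)) v) = 0"
      using J(2) by (simp add: sum.reindex the_inv_into_f_f)
    moreover have "\<forall>v\<in>x ` J. u v = 0" if "(\<Sum>v\<in>x ` J. fscale (u v) v) = 0" for u
      using that B(2) finJ J(3) fv.dependent_finite[of "x ` J"] by auto
    note this[of "\<lambda>v. a (the_inv_into J x v)"]
    ultimately have "\<forall>v\<in>x ` J. a (the_inv_into J x v) = 0" by blast
    then show "\<forall>j\<in>J. a j = 0" using J(2) by (simp add: the_inv_into_f_f)
  qed (use K finJ in auto)
  moreover have "card B = card J" using J by (simp add: card_image)
  ultimately show ?thesis using B(3) by simp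
qed

section \<open>The system matrix and the cut matrix in terms of ports\<close>

lemma sum_nth_distinct: "distinct xs \<Longrightarrow> (\<Sum>j<length xs. f (xs ! j)) = (\<Sum>x\<in>set xs. f x)"
  using sum.reindex_bij_betw[OF bij_betw_nth[of xs "{..<length xs}" "set xs"], of f] by simp

text \<open>\<open>u k p\<close> is the response of destination process \<open>k\<close> to a unit
  symbol injected at port \<open>p\<close>, an entry of \<open>(I - F)^-1 * B^T\<close>. The
  recursion is \<open>(I - F) * u = B^T\<close> read row by row.\<close>

lemma system_matrix_columns:
  fixes G :: "('v, 'p) network" and \<beta> :: "'p \<times> 'p \<Rightarrow> 'a::field"
  assumes G: "acyclic_network G" and es: "distinct es" "set es = ports G"
  obtains u :: "nat \<Rightarrow> 'p \<Rightarrow> 'a" where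
    "system_matrix G es S T \<mu> \<nu> \<alpha> \<beta> \<epsilon>
      = mat \<mu> \<nu> (\<lambda>(i, k). \<Sum>p\<in>ports G. (if p \<in> outputs G S then \<alpha> (i, p) else 0) * u k p)"
    "\<And>k p. k < \<nu> \<Longrightarrow> p \<in> ports G \<Longrightarrow> u k p = (\<Sum>q\<in>ports G. coef G \<beta> p q * u k q)
      + (if p \<in> inputs G T then \<epsilon> (p, (T, k)) else 0)"
proof -
  define n where "n = length es"
  define D where "D = 1\<^sub>m n - F_mat G es \<beta>"
  have D: "D \<in> carrier_mat n n" 
    unfolding D_def by (rule minus_carrier_mat) (simp add: F_mat_def n_def)
  obtain N where N: "mat_inverse D = Some N" "N \<in> carrier_mat n n" "D * N = 1\<^sub>m n"
    using I_minus_F_inverse[OF G es, of \<beta>] unfolding D_def n_def by metis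
  define A where "A = A_mat G es S \<mu> \<alpha>"
  define B where "B = transpose_mat (B_mat G es T \<nu> \<epsilon>)"
  have A: "A \<in> carrier_mat \<mu> n" and B: "B \<in> carrier_mat n \<nu>"
    by (simp_all add: A_def A_mat_def B_def B_mat_def n_def)
  define X where "X = N * B"
  have X: "X \<in> carrier_mat n \<nu>" using N B by (simp add: X_def)
  define u where "u k p = X $$ (the_inv_into {..<n} ((!) es) p, k)" for k p
  have u_nth: "u k (es ! j) = X $$ (j, k)" if "j < n" for j k
    using es(1) that by (simp add: u_def n_def inj_on_nth the_inv_into_f_f)
  show thesis
  proof (rule that[of u])
    have "system_matrix G es S T \<mu> \<nu> \<alpha> \<beta> \<epsilon> = A * N * B"
      using N(1) by (simp add: system_matrix_def A_def B_def D_def n_def)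
    also have "\<dots> = A * X" unfolding X_def using A N(2) B by (rule assoc_mult_mat)
    also have "\<dots> = mat \<mu> \<nu> (\<lambda>(i, k). \<Sum>p\<in>ports G. (if p \<in> outputs G S then \<alpha> (i, p) else 0) * u k p)"
    proof (rule eq_matI)
      fix i k assume "i < dim_row (mat \<mu> \<nu> (\<lambda>(i, k). \<Sum>p\<in>ports G. (if p \<in> outputs G S then \<alpha> (i, p) else 0) * u k p))"
        "k < dim_col (mat \<mu> \<nu> (\<lambda>(i, k). \<Sum>p\<in>ports G. (if p \<in> outputs G S then \<alpha> (i, p) else 0) * u k p))"
      then have ik: "i < \<mu>" "k < \<nu>" by simp_all
      then have "(A * X) $$ (i, k) = (\<Sum>j<n. A $$ (i, j) * X $$ (j, k))"
        using A X by (simp add: scalar_prod_def lessThan_atLeast0)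
      also have "\<dots> = (\<Sum>j<n. (if es ! j \<in> outputs G S then \<alpha> (i, es ! j) else 0) * u k (es ! j))"
        using ik by (intro sum.cong refl) (simp add: A_def A_mat_def n_def u_nth)
      also have "\<dots> = (\<Sum>p\<in>ports G. (if p \<in> outputs G S then \<alpha> (i, p) else 0) * u k p)"
        using sum_nth_distinct[OF es(1), of "\<lambda>p. (if p \<in> outputs G S then \<alpha> (i, p) else 0) * u k p"] es(2) n_def by simp
      finally show "(A * X) $$ (i, k) = mat \<mu> \<nu> (\<lambda>(i, k).
        \<Sum>p\<in>ports G. (if p \<in> outputs G S then \<alpha> (i, p) else 0) * u k p) $$ (i, k)"
        using ik by simp
    qed (use A X in auto)
    finally show "system_matrix G es S T \<mu> \<nu> \<alpha> \<beta> \<epsilon>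
      = mat \<mu> \<nu> (\<lambda>(i, k). \<Sum>p\<in>ports G. (if p \<in> outputs G S then \<alpha> (i, p) else 0) * u k p)" .
  next
    fix k p assume k: "k < \<nu>" and "p \<in> ports G"
    then obtain i where i: "i < n" "p = es ! i" using es(2) by (metis in_set_conv_nth n_def)
    have "D * X = B"
      unfolding X_def using assoc_mult_mat[OF D N(2) B] N(3) B by simp
    then have "B $$ (i, k) = (\<Sum>j<n. D $$ (i, j) * X $$ (j, k))"
      using D X i k by (auto simp: scalar_prod_def lessThan_atLeast0)
    also have "\<dots> = (\<Sum>j<n. (if i = j then u k (es ! j) else 0) - coef G \<beta> p (es ! j) * u k (es ! j))"
      using i by (intro sum.cong refl)
        (auto simp: D_def F_mat_def n_def u_nth coef_def algebra_simps)
    also have "\<dots> = u k p - (\<Sum>j<n. coef G \<beta> p (es ! j) * u k (es ! j))"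
      using i by (simp add: sum_subtractf)
    also have "(\<Sum>j<n. coef G \<beta> p (es ! j) * u k (es ! j)) = (\<Sum>q\<in>ports G. coef G \<beta> p q * u k q)"
      using sum_nth_distinct[OF es(1), of "\<lambda>q. coef G \<beta> p q * u k q"] es(2) n_def by simp
    also have "B $$ (i, k) = (if p \<in> inputs G T then \<epsilon> (p, (T, k)) else 0)"
      using i k by (simp add: B_def B_mat_def n_def)
    finally show "u k p = (\<Sum>q\<in>ports G. coef G \<beta> p q * u k q)
      + (if p \<in> inputs G T then \<epsilon> (p, (T, k)) else 0)"
      by (simp add: algebra_simps)
  qed
qed

lemma mat_rank_cut_matrix_eq_dim:
  assumes G: "network G" and es: "distinct es" "set es = ports G" and \<Omega>: "\<Omega> \<subseteq> nodes G"
  shows "mat_rank (cut_matrix G es \<Omega> :: 'a::field mat)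
    = fv.dim ((\<lambda>q p. if p \<in> outs G \<Omega> \<and> (p, q) \<in> edges G then 1 else 0 :: 'a) ` ins G (nodes G - \<Omega>))"
proof -
  define rs where "rs = filter (\<lambda>e. \<exists>V\<in>\<Omega>. e \<in> outputs G V) es"
  define cs where "cs = filter (\<lambda>e. \<exists>V\<in>nodes G - \<Omega>. e \<in> inputs G V) es"
  have rs: "distinct rs" "set rs = outs G \<Omega>"
    using es \<Omega> by (auto simp: rs_def outs_def ports_def)
  have cs: "set cs = ins G (nodes G - \<Omega>)"
    using es by (auto simp: cs_def ins_def ports_def)
  have "port_fun rs (vec (length rs) (\<lambda>i. if (rs ! i, cs ! j) \<in> edges G then 1 else 0 :: 'a))
      = (\<lambda>q p. if p \<in> outs G \<Omega> \<and> (p, q) \<in> edges G then 1 else 0) (cs ! j)" for j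
    using rs by (intro port_fun_eqI) (auto dest: nth_mem)
  then have "mat_rank (cut_matrix G es \<Omega> :: 'a mat) = fv.dim ((\<lambda>j.
      (\<lambda>q p. if p \<in> outs G \<Omega> \<and> (p, q) \<in> edges G then 1 else 0 :: 'a) (cs ! j)) ` {..<length cs})"
    unfolding cut_matrix_def Let_def rs_def[symmetric] cs_def[symmetric]
    by (simp add: mat_rank_mat_eq_dim[OF rs(1)])
  also have "(\<lambda>j. (\<lambda>q p. if p \<in> outs G \<Omega> \<and> (p, q) \<in> edges G then 1 else 0 :: 'a) (cs ! j)) ` {..<length cs}
    = (\<lambda>q p. if p \<in> outs G \<Omega> \<and> (p, q) \<in> edges G then 1 else 0) ` ((!) cs ` {..<length cs})"
    by (simp add: image_image)
  also have "(!) cs ` {..<length cs} = ins G (nodes G - \<Omega>)"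
    using cs by (auto simp: set_conv_nth)
  finally show ?thesis .
qed

subsection \<open>The two inequalities\<close>

lemma coef_at_input:
  assumes G: "network G" and V: "V \<in> nodes G" "p \<in> inputs G V"
  shows "coef G \<beta> p q = (if q \<in> outputs G V then \<beta> (p, q) else 0)"
proof -
  have "(p, q) \<notin> edges G"
    using edge_ports(1)[OF G, of p q] inputs_outputs_disjoint[OF G V(1) _ V(2)]
    by (auto simp: outs_def)
  moreover have "(\<exists>W\<in>nodes G. p \<in> inputs G W \<and> q \<in> outputs G W) \<longleftrightarrow> q \<in> outputs G V"
    using V inputs_unique[OF G] by blast
  ultimately show ?thesis by (simp add: coef_def)
qed

lemma coef_at_output:
  assumes G: "network G" and V: "V \<in> nodes G" "p \<in> outputs G V"
  shows "coef G \<beta> p q = (if (p, q) \<in> edges G then 1 else 0)"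
  using V inputs_outputs_disjoint[OF G] by (auto simp: coef_def)

text \<open>Responses are determined by later ports: an output by the inputs its edges reach, an
  input by the outputs of its node. The induction therefore starts at nodes without successors.
  Edges from \<Omega> lead either into \<Omega>, where the induction hypothesis applies, or across
  the cut, where the total contribution is 0 by \<open>cut\<close>.\<close>

lemma vanishing_behind_cut:
  fixes w :: "'p \<Rightarrow> 'a::field"
  assumes ac: "acyclic_network G" and \<Omega>: "\<Omega> \<subseteq> nodes G"
    and w: "\<And>p. p \<in> ins G \<Omega> \<union> outs G \<Omega> \<Longrightarrow> w p = (\<Sum>q\<in>ports G. coef G \<beta> p q * w q)"
    and cut: "\<And>p. p \<in> outs G \<Omega> \<Longrightarrow>
      (\<Sum>q\<in>ins G (nodes G - \<Omega>). w q * (if (p, q) \<in> edges G then 1 else 0)) = 0"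
    and V: "V \<in> \<Omega>" "p \<in> inputs G V \<union> outputs G V"
  shows "w p = 0"
proof -
  have G: "network G" and acyc: "acyclic (node_arcs G)"
    using ac by (auto simp: acyclic_network_def)
  have "finite (node_arcs G)"
    by (rule finite_subset[of _ "nodes G \<times> nodes G"])
      (use finite_nodes[OF G] in \<open>auto simp: node_arcs_def\<close>)
  then have "wf ((node_arcs G)\<inverse>)" using acyc by (simp add: finite_acyclic_wf_converse)
  then show ?thesis using V
  proof (induction V arbitrary: p rule: wf_induct_rule)
    case (less V)
    have Vn: "V \<in> nodes G" using less.prems(1) \<Omega> by blast
    have out: "w p = 0" if p: "p \<in> outputs G V" for p
    proof -
      have pO: "p \<in> outs G \<Omega>" using p less.prems(1) by (auto simp: outs_def)
      have split: "ins G (nodes G) = ins G \<Omega> \<union> ins G (nodes G - \<Omega>)"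
        using \<Omega> by (auto simp: ins_def)
      have "w p = (\<Sum>q\<in>ports G. coef G \<beta> p q * w q)" using w pO by blast
      also have "\<dots> = (\<Sum>q\<in>ins G (nodes G). w q * (if (p, q) \<in> edges G then 1 else 0))"
        using finite_ports[OF G] edge_ports(2)[OF G, of p]
        by (intro sum.mono_neutral_cong_right)
          (auto simp: ports_eq[OF G] coef_at_output[OF G Vn p])
      also have "\<dots> = (\<Sum>q\<in>ins G \<Omega>. w q * (if (p, q) \<in> edges G then 1 else 0))
          + (\<Sum>q\<in>ins G (nodes G - \<Omega>). w q * (if (p, q) \<in> edges G then 1 else 0))"
        unfolding split using \<Omega> ins_unique[OF G, of \<Omega> "nodes G - \<Omega>"]
        by (intro sum.union_disjoint finite_ins[OF G]) auto
      also have "(\<Sum>q\<in>ins G \<Omega>. w q * (if (p, q) \<in> edges G then 1 else 0)) = 0"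
      proof (intro sum.neutral ballI)
        fix q assume "q \<in> ins G \<Omega>"
        then obtain W where W: "W \<in> \<Omega>" "q \<in> inputs G W" by (auto simp: ins_def)
        have "w q = 0" if "(p, q) \<in> edges G"
        proof (rule less.IH)
          show "(W, V) \<in> (node_arcs G)\<inverse>"
            using W \<Omega> Vn p that by (auto simp: node_arcs_def)
        qed (use W in auto)
        then show "w q * (if (p, q) \<in> edges G then 1 else 0) = 0" by simp
      qed
      finally show ?thesis using cut[OF pO] by simp
    qed
    show ?case
    proof (cases "p \<in> outputs G V")
      case True
      then show ?thesis by (rule out)
    next
      case False
      then have p: "p \<in> inputs G V" using less.prems(2) by blast
      then have "w p = (\<Sum>q\<in>ports G. coef G \<beta> p q * w q)"
        using less.prems(1) by (intro w) (auto simp: ins_def)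
      also have "\<dots> = 0"
        by (intro sum.neutral) (auto simp: coef_at_input[OF G Vn p] out)
      finally show ?thesis .
    qed
  qed
qed

text \<open>\<open>z k\<close> is the cut matrix applied to the response \<open>u k\<close>. A
  combination of responses that this sends to 0 vanishes on the outputs of \<open>S\<close>, so
  every relation among the \<open>z k\<close> holds among the columns \<open>x k\<close> of the
  system matrix. The \<open>z k\<close> lie in the column space of the cut matrix.\<close>

lemma rank_system_matrix_le_cut:
  fixes G :: "('v, 'p) network" and \<beta> :: "'p \<times> 'p \<Rightarrow> 'a::field"
  assumes ac: "acyclic_network G" and es: "distinct es" "set es = ports G"
    and cut: "is_cut G S T \<Omega>"
  shows "mat_rank (system_matrix G es S T \<mu> \<nu> \<alpha> \<beta> \<epsilon>)
    \<le> mat_rank (cut_matrix G es \<Omega> :: 'a mat)"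
proof -
  have G: "network G" using ac by (simp add: acyclic_network_def)
  have \<Omega>: "\<Omega> \<subseteq> nodes G" "S \<in> \<Omega>" "T \<in> nodes G" "T \<notin> \<Omega>" using cut by (auto simp: is_cut_def)
  obtain u :: "nat \<Rightarrow> 'p \<Rightarrow> 'a" where
    M: "system_matrix G es S T \<mu> \<nu> \<alpha> \<beta> \<epsilon>
      = mat \<mu> \<nu> (\<lambda>(i, k). \<Sum>p\<in>ports G. (if p \<in> outputs G S then \<alpha> (i, p) else 0) * u k p)"
    and u: "\<And>k p. k < \<nu> \<Longrightarrow> p \<in> ports G \<Longrightarrow> u k p = (\<Sum>q\<in>ports G. coef G \<beta> p q * u k q)
      + (if p \<in> inputs G T then \<epsilon> (p, (T, k)) else 0)"
    by (rule system_matrix_columns[OF ac es, where \<alpha> = \<alpha> and \<beta> = \<beta> and \<epsilon> = \<epsilon> and \<mu> = \<mu> and \<nu> = \<nu> and S = S and T = T]) (rule that)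
  define x where "x k i = (if i < \<mu>
    then \<Sum>p\<in>ports G. (if p \<in> outputs G S then \<alpha> (i, p) else 0) * u k p else 0)" for k i
  define y where "y q p = (if p \<in> outs G \<Omega> \<and> (p, q) \<in> edges G then 1 else 0 :: 'a)" for q p
  define z where "z k = (\<Sum>q\<in>ins G (nodes G - \<Omega>). fscale (u k q) (y q))" for k
  have "port_fun [0..<\<mu>] (vec (length [0..<\<mu>]) (\<lambda>i. case (i, k) of (i, k) \<Rightarrow>
      \<Sum>p\<in>ports G. (if p \<in> outputs G S then \<alpha> (i, p) else 0) * u k p)) = x k" for k
    by (intro port_fun_eqI) (auto simp: x_def)
  then have "mat_rank (system_matrix G es S T \<mu> \<nu> \<alpha> \<beta> \<epsilon>) = fv.dim (x ` {..<\<nu>})"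
    unfolding M using mat_rank_mat_eq_dim[of "[0..<\<mu>]" \<nu>, where ?'k = 'a] by simp
  also have "\<dots> \<le> fv.dim (z ` {..<\<nu>})"
  proof (rule dim_le_of_relations)
    fix a assume a: "(\<Sum>k<\<nu>. fscale (a k) (z k)) = 0"
    define w where "w p = (\<Sum>k<\<nu>. a k * u k p)" for p
    have w_zero: "w p = 0" if "p \<in> outputs G S" for p
    proof (rule vanishing_behind_cut[OF ac \<Omega>(1)])
      fix p assume p: "p \<in> ins G \<Omega> \<union> outs G \<Omega>"
      then have pG: "p \<in> ports G" using \<Omega>(1) by (auto simp: ins_def outs_def ports_def)
      \<comment> \<open>\<open>T\<close> lies beyond the cut, so the inhomogeneous term with
        \<epsilon> is absent on the ports of \<Omega>.\<close>
      have pT: "p \<notin> inputs G T"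
        using p
      proof
        assume "p \<in> ins G \<Omega>"
        then show ?thesis using ins_unique[OF G \<Omega>(1), of "{T}" p] \<Omega>(3,4) by simp
      next
        assume "p \<in> outs G \<Omega>"
        then show ?thesis using ins_outs_disjoint[OF G _ \<Omega>(1), of "{T}" p] \<Omega>(3) by auto
      qed
      have "u k p = (\<Sum>q\<in>ports G. coef G \<beta> p q * u k q)" if "k < \<nu>" for k
        using u[OF that pG] unfolding if_not_P[OF pT] add_0_right .
      then have "w p = (\<Sum>k<\<nu>. a k * (\<Sum>q\<in>ports G. coef G \<beta> p q * u k q))"
        unfolding w_def by (intro sum.cong refl arg_cong2[where f = "(*)"]) simp
      also have "\<dots> = (\<Sum>q\<in>ports G. coef G \<beta> p q * w q)"
        unfolding w_def sum_distrib_left by (subst sum.swap) (simp add: mult_ac)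
      finally show "w p = (\<Sum>q\<in>ports G. coef G \<beta> p q * w q)" .
    next
      fix p assume p: "p \<in> outs G \<Omega>"
      have "(\<Sum>q\<in>ins G (nodes G - \<Omega>). w q * (if (p, q) \<in> edges G then 1 else 0))
          = (\<Sum>k<\<nu>. fscale (a k) (z k)) p"
        unfolding w_def z_def sum_fun_apply fscale_apply sum_distrib_left sum_distrib_right
        by (subst sum.swap) (simp add: y_def p mult_ac)
      then show "(\<Sum>q\<in>ins G (nodes G - \<Omega>). w q * (if (p, q) \<in> edges G then 1 else 0)) = 0"
        using a by simp
    qed (use \<Omega>(2) that in auto)
    show "(\<Sum>k<\<nu>. fscale (a k) (x k)) = 0"
    proof
      fix i
      have "(\<Sum>k<\<nu>. a k * (\<Sum>p\<in>ports G. (if p \<in> outputs G S then \<alpha> (i, p) else 0) * u k p))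
          = (\<Sum>p\<in>ports G. (if p \<in> outputs G S then \<alpha> (i, p) else 0) * w p)"
        unfolding w_def sum_distrib_left by (subst sum.swap) (simp add: mult_ac)
      also have "\<dots> = 0" by (intro sum.neutral) (auto simp: w_zero)
      finally show "(\<Sum>k<\<nu>. fscale (a k) (x k)) i = 0 i"
        by (cases "i < \<mu>") (simp_all add: sum_fun_apply fscale_apply x_def)
    qed
  qed simp
  also have "\<dots> \<le> fv.dim (y ` ins G (nodes G - \<Omega>))"
  proof (rule fv.dim_mono_finite)
    show "finite (y ` ins G (nodes G - \<Omega>))" using finite_ins[OF G] by simp
    have "z k \<in> fv.span (y ` ins G (nodes G - \<Omega>))" for k
      unfolding z_def by (intro fv.span_sum fv.span_scale[OF fv.span_base] imageI)
    then show "z ` {..<\<nu>} \<subseteq> fv.span (y ` ins G (nodes G - \<Omega>))" by blast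
  qed
  also have "\<dots> = mat_rank (cut_matrix G es \<Omega> :: 'a mat)"
    unfolding y_def mat_rank_cut_matrix_eq_dim[OF G es \<Omega>(1)] ..
  finally show ?thesis .
qed

section \<open>Lower bound from the elimination of nodes\<close>

text \<open>For \<open>U = {}\<close> the submatrix of \<open>I - F\<close> is the negated cut
  matrix. The unit vectors at the set \<open>C\<close> of deleted rows add \<open>card C\<close> to
  its rank.\<close>

lemma rank_cut_le_dim_gens:
  assumes G: "network G" and es: "distinct es" "set es = ports G" and \<Omega>: "\<Omega> \<subseteq> nodes G"
  shows "mat_rank (cut_matrix G es \<Omega> :: 'a::field mat) + card (ports G)
    \<le> fv.dim (gens G (\<lambda>_. 0 :: 'a) {} \<Omega> (nodes G - \<Omega>)) + card (outs G \<Omega>)"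
proof -
  define y where "y q p = (if p \<in> outs G \<Omega> \<and> (p, q) \<in> edges G then 1 else 0 :: 'a)" for q p
  define C where "C = ports G - outs G \<Omega>"
  define W where "W = nodes G - \<Omega>"
  have W: "W \<subseteq> nodes G" by (auto simp: W_def)
  have finC: "finite C" using finite_ports[OF G] by (simp add: C_def)
  have sub: "outs G \<Omega> \<subseteq> ports G" using \<Omega> by (auto simp: outs_def ports_def)
  have C: "C = ins G \<Omega> \<union> ins G W \<union> outs G W"
  proof -
    have "ports G = ins G \<Omega> \<union> ins G W \<union> outs G W \<union> outs G \<Omega>"
      using \<Omega> by (auto simp: W_def ports_eq[OF G] ins_def outs_def)
    moreover have "p \<notin> ins G \<Omega>" "p \<notin> ins G W" "p \<notin> outs G W" if "p \<in> outs G \<Omega>" for p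
      using that ins_outs_disjoint[OF G \<Omega> \<Omega>] ins_outs_disjoint[OF G W \<Omega>]
        outs_unique[OF G \<Omega> W] by (auto simp: W_def)
    ultimately show ?thesis unfolding C_def by blast
  qed
  have "y q \<in> fv.span (gens G (\<lambda>_. 0) {} \<Omega> W)" if q: "q \<in> ins G W" for q
  proof -
    \<comment> \<open>On the outputs of \<Omega> the column of \<open>q\<close> equals
      \<open>- y q\<close>, so the sum is supported on the deleted rows.\<close>
    have "y q + col_fun G (\<lambda>_. 0) q \<in> fv.span (unit_fun ` C)"
    proof (rule supported_in_span_units[OF finC])
      fix p assume p: "p \<notin> C"
      then have "p \<noteq> q" using q C by blast
      moreover have "q \<in> ins G (nodes G)" using q W by (auto simp: ins_def)
      moreover have "p \<in> outs G \<Omega>" if "(p, q) \<in> edges G"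
        using p edge_ports(1)[OF G that] by (auto simp: C_def ports_eq[OF G])
      ultimately show "(y q + col_fun G (\<lambda>_. 0) q) p = 0"
        by (auto simp: y_def col_fun_def coef_input[OF G] unit_fun_apply)
    qed
    then have "y q + col_fun G (\<lambda>_. 0) q \<in> fv.span (gens G (\<lambda>_. 0) {} \<Omega> W)"
      using fv.span_mono[of "unit_fun ` C"] by (auto simp: gens_def C)
    moreover have "col_fun G (\<lambda>_. 0) q \<in> fv.span (gens G (\<lambda>_. 0) {} \<Omega> W)"
      using q by (intro fv.span_base) (auto simp: gens_def)
    ultimately have "(y q + col_fun G (\<lambda>_. 0) q) - col_fun G (\<lambda>_. 0) q
      \<in> fv.span (gens G (\<lambda>_. 0) {} \<Omega> W)"
      by (rule fv.span_diff)
    then show ?thesis by simp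
  qed
  moreover have "unit_fun ` C \<subseteq> fv.span (gens G (\<lambda>_. 0 :: 'a) {} \<Omega> W)"
    using fv.span_superset[of "gens G (\<lambda>_. 0 :: 'a) {} \<Omega> W"] by (auto simp: gens_def C)
  ultimately have "fv.dim (y ` ins G W \<union> unit_fun ` C) \<le> fv.dim (gens G (\<lambda>_. 0 :: 'a) {} \<Omega> W)"
    using finite_gens[OF G empty_subsetI \<Omega> W, of "\<lambda>_. 0 :: 'a"] by (intro fv.dim_mono_finite) auto
  moreover have "fv.dim (y ` ins G W) + card C \<le> fv.dim (y ` ins G W \<union> unit_fun ` C)"
    using finite_ins[OF G W] finC
    by (intro dim_Un_unit_coordinates) (auto simp: y_def C_def unit_fun_apply)
  moreover have "card C + card (outs G \<Omega>) = card (ports G)"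
    using sub finite_ports[OF G] unfolding C_def
    by (metis card_Diff_subset card_mono finite_subset le_add_diff_inverse2)
  moreover have "mat_rank (cut_matrix G es \<Omega> :: 'a mat) = fv.dim (y ` ins G W)"
    unfolding y_def W_def by (rule mat_rank_cut_matrix_eq_dim[OF G es \<Omega>])
  ultimately show ?thesis unfolding W_def by linarith
qed

text \<open>With selecting \<alpha> and \<epsilon> the system matrix is the block of
  \<open>(I - F)^-1\<close> with rows at the outputs of \<open>S\<close> and columns at the inputs
  of \<open>T\<close>. A unit vector at an input of \<open>T\<close> combines the columns of
  \<open>I - F\<close> with the responses as coefficients. Hence this block together with the
  columns of all ports except the outputs of \<open>S\<close> spans \<open>gens\<close>, up to a
  trade at the inputs of \<open>S\<close>.\<close>

lemma rank_system_matrix_ge_dim_gens: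
  fixes G :: "('v, 'p) network" and \<beta> :: "'p \<times> 'p \<Rightarrow> 'a::field"
  assumes ac: "acyclic_network G" and es: "distinct es" "set es = ports G"
    and ST: "S \<in> nodes G" "T \<in> nodes G" "S \<noteq> T"
  obtains \<alpha> \<nu> and \<beta>' :: "'p \<times> 'p \<Rightarrow> 'a" and \<epsilon> where
    "fv.dim (gens G \<beta> (nodes G - {S, T}) {S} {T}) + card (outputs G S)
      \<le> mat_rank (system_matrix G es S T (card (outputs G S)) \<nu> \<alpha> \<beta>' \<epsilon>) + card (ports G)"
proof -
  have G: "network G" using ac by (simp add: acyclic_network_def)
  define U where "U = nodes G - {S, T}"
  have U: "U \<subseteq> nodes G" "S \<notin> U" "T \<notin> U" by (auto simp: U_def)
  \<comment> \<open>The columns of the outputs of \<open>S\<close> and \<open>T\<close> do not occur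
    in \<open>gens\<close>; zero coefficients turn them into unit vectors.\<close>
  define \<beta>' where "\<beta>' = (\<lambda>(p, q). if q \<in> outputs G S \<union> outputs G T then 0 else \<beta> (p, q))"
  define rs where "rs = filter (\<lambda>e. e \<in> outputs G S) es"
  define cs where "cs = filter (\<lambda>e. e \<in> inputs G T) es"
  have rs: "distinct rs" "set rs = outputs G S" using es ST by (auto simp: rs_def ports_def)
  have cs: "distinct cs" "set cs = inputs G T" using es ST by (auto simp: cs_def ports_def)
  have len: "length rs = card (outputs G S)" using rs distinct_card by metis
  define \<alpha> :: "nat \<times> 'p \<Rightarrow> 'a" where "\<alpha> = (\<lambda>(i, p). if p = rs ! i then 1 else 0)"
  define \<epsilon> :: "'p \<times> ('v \<times> nat) \<Rightarrow> 'a" where "\<epsilon> = (\<lambda>(p, (_, k)). if p = cs ! k then 1 else 0)"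
  obtain u :: "nat \<Rightarrow> 'p \<Rightarrow> 'a" where
    M: "system_matrix G es S T (length rs) (length cs) \<alpha> \<beta>' \<epsilon>
      = mat (length rs) (length cs)
          (\<lambda>(i, k). \<Sum>p\<in>ports G. (if p \<in> outputs G S then \<alpha> (i, p) else 0) * u k p)"
    and u: "\<And>k p. k < length cs \<Longrightarrow> p \<in> ports G \<Longrightarrow> u k p
      = (\<Sum>q\<in>ports G. coef G \<beta>' p q * u k q) + (if p \<in> inputs G T then \<epsilon> (p, (T, k)) else 0)"
    by (rule system_matrix_columns[OF ac es, where \<alpha> = \<alpha> and \<beta> = \<beta>' and \<epsilon> = \<epsilon>
          and \<mu> = "length rs" and \<nu> = "length cs" and S = S and T = T]) (rule that)
  \<comment> \<open>Column \<open>k\<close> of the system matrix, placed on the outputs of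
    \<open>S\<close>.\<close>
  define h where "h k p = (if p \<in> outputs G S then u k p else 0)" for k p
  have subS: "outputs G S \<subseteq> ports G" using ST by (auto simp: ports_def)
  have "port_fun rs (vec (length rs) (\<lambda>i. case (i, k) of (i, k) \<Rightarrow>
      \<Sum>p\<in>ports G. (if p \<in> outputs G S then \<alpha> (i, p) else 0) * u k p)) = h k" for k
  proof (rule port_fun_eqI[OF rs(1)])
    fix i assume i: "i < length rs"
    then have "rs ! i \<in> outputs G S" using rs(2) nth_mem by blast
    moreover have "(\<Sum>p\<in>ports G. (if p \<in> outputs G S then \<alpha> (i, p) else 0) * u k p)
        = (\<Sum>p\<in>ports G. if p = rs ! i then u k p else 0)"
      using calculation by (intro sum.cong) (auto simp: \<alpha>_def)
    ultimately show "h k (rs ! i) = vec (length rs) (\<lambda>i. case (i, k) of (i, k) \<Rightarrow>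
      \<Sum>p\<in>ports G. (if p \<in> outputs G S then \<alpha> (i, p) else 0) * u k p) $ i"
      using i subS finite_ports[OF G] by (auto simp: h_def)
  qed (simp add: rs h_def)
  then have rank: "mat_rank (system_matrix G es S T (length rs) (length cs) \<alpha> \<beta>' \<epsilon>)
      = fv.dim (h ` {..<length cs})"
    unfolding M using mat_rank_mat_eq_dim[OF rs(1), where ?'k = 'a] by simp
  have col_ST: "col_fun G \<beta>' q = unit_fun q" if "q \<in> outputs G S \<union> outputs G T" for q
  proof -
    have "\<exists>V\<in>{S, T}. q \<in> outputs G V" using that by simp
    then obtain V where V: "V \<in> {S, T}" "q \<in> outputs G V" ..
    then have "V \<in> nodes G" using ST by blast
    then have "coef G \<beta>' p q = 0" for p
      using coef_output[OF G _ V(2), of \<beta>' p] that by (simp add: \<beta>'_def)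
    then show ?thesis by (simp add: col_fun_def fun_eq_iff)
  qed
  have col_other: "col_fun G \<beta>' q = col_fun G \<beta> q" if "q \<in> ins G (nodes G) \<union> outs G U" for q
  proof (rule col_cong)
    have notin: "q \<notin> outputs G V" if V: "V \<in> nodes G" "V \<notin> U" for V
    proof
      assume "q \<in> outputs G V"
      then have "q \<in> outs G {V}" by simp
      with \<open>q \<in> ins G (nodes G) \<union> outs G U\<close> show False
        using V ins_outs_disjoint[OF G order_refl, of "{V}" q] outs_unique[OF G U(1), of "{V}" q]
        by blast
    qed
    from notin[OF ST(1) U(2)] notin[OF ST(2) U(3)] show "\<beta>' (p, q) = \<beta> (p, q)" for p by (simp add: \<beta>'_def)
  qed
  have gens: "gens G \<beta> U {S} {T} = gens G \<beta>' U {S} {T}"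
  proof -
    have "ins G U \<union> ins G {T} \<subseteq> ins G (nodes G)" using U ST by (auto simp: ins_def)
    then have "col_fun G \<beta>' ` (ins G U \<union> outs G U \<union> ins G {T})
        = col_fun G \<beta> ` (ins G U \<union> outs G U \<union> ins G {T})"
      by (intro image_cong refl col_other) blast
    then show ?thesis by (simp add: gens_def)
  qed
  define B where "B = col_fun G \<beta>' ` (ins G U \<union> outs G U \<union> inputs G T)
    \<union> unit_fun ` (inputs G T \<union> outputs G T)"
  define Q where "Q = col_fun G \<beta>' ` (ports G - outputs G S) \<union> h ` {..<length cs}"
  have finB: "finite B"
    using finite_ins[OF G U(1)] finite_outs[OF G U(1)] finite_inputs[OF G] finite_outputs[OF G] ST
    by (simp add: B_def)
  have finQ: "finite Q" using finite_ports[OF G] by (simp add: Q_def)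
  have "gens G \<beta>' U {S} {T} = B \<union> unit_fun ` inputs G S"
    by (simp only: gens_def B_def ins_insert outs_insert ins_empty outs_empty image_Un Un_ac Un_empty_right Un_empty_left)
  \<comment> \<open>The columns of the inputs of \<open>S\<close> belong to \<open>Q\<close>, so
    they take the place of the unit vectors there.\<close>
  also have "fv.dim \<dots> \<le> fv.dim (B \<union> col_fun G \<beta>' ` inputs G S)"
  proof (rule dim_Un_unit_coordinates_replace[OF finB finite_inputs[OF G ST(1)]])
    have nin: "p \<in> ins G (nodes G)" if "p \<in> inputs G V" "V \<in> nodes G" for p V
      using that by (auto simp: ins_def)
    show "col_fun G \<beta>' c' c = (if c = c' then 1 else 0)"
      if "c \<in> inputs G S" "c' \<in> inputs G S" for c c'
      using that ST by (simp add: col_input_at_input[OF G] nin)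
    fix v c assume v: "v \<in> B" and c: "c \<in> inputs G S"
    have in_zero: "col_fun G \<beta>' q c = 0" if "V \<in> nodes G" "V \<noteq> S" "q \<in> inputs G V" for V q
    proof -
      have "q \<noteq> c" using inputs_unique[OF G, of V S c] that c ST by blast
      then show ?thesis using that c ST by (simp add: col_input_at_input[OF G] nin)
    qed
    have "col_fun G \<beta>' q c = 0" if "q \<in> ins G U" for q
      using that in_zero U by (auto simp: ins_def)
    moreover have "col_fun G \<beta>' q c = 0" if "q \<in> outs G U" for q
      using col_output_at_input[OF G U(1) ST(1) U(2) that c] .
    moreover have "col_fun G \<beta>' q c = 0" if "q \<in> inputs G T" for q
      using that in_zero ST by blast
    moreover have "unit_fun q c = (0 :: 'a)" if "q \<in> inputs G T \<union> outputs G T" for q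
      using that c ST inputs_unique[OF G, of S T c] inputs_outputs_disjoint[OF G, of S T c]
      by (auto simp: unit_fun_apply)
    ultimately show "v c = 0" using v unfolding B_def by blast
  qed
  also have "\<dots> \<le> fv.dim Q"
  proof (rule fv.dim_mono_finite[OF finQ])
    have "col_fun G \<beta>' q \<in> fv.span Q" if "q \<in> ports G - outputs G S" for q
      using that by (intro fv.span_base) (auto simp: Q_def)
    moreover have "ins G U \<union> outs G U \<union> inputs G T \<union> inputs G S \<union> outputs G T
        \<subseteq> ports G - outputs G S"
      using ST U outs_unique[OF G U(1), of "{S}"] outputs_unique[OF G, of S T]
        inputs_outputs_disjoint[OF G _ ST(1)]
      by (fastforce simp: ports_def ins_def outs_def)
    ultimately have cols: "col_fun G \<beta>' q \<in> fv.span Q"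
      if "q \<in> ins G U \<union> outs G U \<union> inputs G T \<union> inputs G S \<union> outputs G T" for q
      using that by blast
    have "unit_fun q \<in> fv.span Q" if q: "q \<in> inputs G T" for q
    proof -
      obtain k where k: "k < length cs" "q = cs ! k" using q cs by (metis in_set_conv_nth)
      \<comment> \<open>Column \<open>k\<close> of \<open>(I - F) * u = B^T\<close>, with the
        unit-vector columns of the outputs of \<open>S\<close> collected in
        \<open>h k\<close>.\<close>
      have "unit_fun q = (\<Sum>r\<in>ports G - outputs G S. fscale (u k r) (col_fun G \<beta>' r)) + h k"
      proof
        fix p
        have h: "h k p = (\<Sum>r\<in>outputs G S. u k r * col_fun G \<beta>' r p)"
        proof -
          have "(\<Sum>r\<in>outputs G S. u k r * col_fun G \<beta>' r p)
              = (\<Sum>r\<in>outputs G S. if p = r then u k r else 0)"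
            by (intro sum.cong) (auto simp: col_ST unit_fun_apply)
          then show ?thesis using finite_outputs[OF G ST(1)] by (simp add: h_def)
        qed
        have "(\<Sum>r\<in>ports G - outputs G S. fscale (u k r) (col_fun G \<beta>' r)) p + h k p
            = (\<Sum>r\<in>ports G. u k r * col_fun G \<beta>' r p)"
          unfolding h sum_fun_apply fscale_apply
          using sum.subset_diff[OF subS finite_ports[OF G], of "\<lambda>r. u k r * col_fun G \<beta>' r p"]
          by simp
        also have "\<dots> = (\<Sum>r\<in>ports G. (if p = r then u k r else 0) - coef G \<beta>' p r * u k r)"
          by (intro sum.cong) (auto simp: col_fun_def unit_fun_apply algebra_simps)
        also have "\<dots> = (if p \<in> ports G then u k p else 0) - (\<Sum>r\<in>ports G. coef G \<beta>' p r * u k r)"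
          using finite_ports[OF G] by (simp add: sum_subtractf)
        also have "\<dots> = unit_fun q p"
        proof (cases "p \<in> ports G")
          case True
          then show ?thesis using u[OF k(1) True] q k by (auto simp: \<epsilon>_def unit_fun_apply)
        next
          case False
          then have "p \<noteq> q" using q ST by (auto simp: ports_def)
          moreover have "coef G \<beta>' p r = 0" for r
            using False edge_ports(1)[OF G, of p r] by (auto simp: coef_def ports_def outs_def)
          ultimately show ?thesis using False by (simp add: unit_fun_apply)
        qed
        finally show "unit_fun q p
            = ((\<Sum>r\<in>ports G - outputs G S. fscale (u k r) (col_fun G \<beta>' r)) + h k) p"
          by simp
      qed
      also have "\<dots> \<in> fv.span Q"
        using k(1) by (intro fv.span_add fv.span_sum fv.span_scale fv.span_base) (auto simp: Q_def)
      finally show ?thesis .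
    qed
    moreover have "unit_fun q \<in> fv.span Q" if "q \<in> outputs G T" for q
      using cols[of q] col_ST[of q] that by simp
    ultimately show "B \<union> col_fun G \<beta>' ` inputs G S \<subseteq> fv.span Q"
      using cols unfolding B_def by blast
  qed
  also have "\<dots> \<le> fv.dim (h ` {..<length cs}) + card (col_fun G \<beta>' ` (ports G - outputs G S))"
    unfolding Q_def Un_commute[of "col_fun G \<beta>' ` (ports G - outputs G S)"]
    using finite_ports[OF G] by (intro fv.dim_Un_le) auto
  also have "\<dots> \<le> fv.dim (h ` {..<length cs}) + card (ports G - outputs G S)"
    using finite_ports[OF G] by (intro add_left_mono card_image_le) auto
  finally have "fv.dim (gens G \<beta> U {S} {T}) + card (outputs G S)
      \<le> fv.dim (h ` {..<length cs}) + (card (ports G - outputs G S) + card (outputs G S))"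
    using gens by simp
  also have "card (ports G - outputs G S) + card (outputs G S) = card (ports G)"
    using subS finite_ports[OF G]
    by (metis card_Diff_subset card_mono finite_subset le_add_diff_inverse2)
  finally show thesis using rank len that[of "length cs" \<alpha> \<beta>' \<epsilon>] by (simp add: U_def)
qed

theorem theorem2:
  fixes G :: "('v, 'p) network" and es :: "'p list" and S T :: 'v
  assumes "acyclic_network G"
    and "distinct es" and "set es = ports G"
    and "S \<in> nodes G" and "T \<in> nodes G" and "S \<noteq> T"
  shows "mincut TYPE('a::{field,finite}) G es S T =
           Min {mat_rank (cut_matrix G es \<Omega> :: 'a mat) | \<Omega>. is_cut G S T \<Omega>} \<and>
         Min {mat_rank (cut_matrix G es \<Omega> :: 'a mat) | \<Omega>. is_cut G S T \<Omega>} =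
           Max {mat_rank (system_matrix G es S T \<mu> \<nu> \<alpha> \<beta> \<epsilon> :: 'a mat) | \<mu> \<nu> \<alpha> \<beta> \<epsilon>.
                  \<mu> \<le> card (outputs G S)}"
    (is "_ \<and> Min ?C = Max ?R")
proof
  have G: "network G" using assms(1) by (simp add: acyclic_network_def)
  note C = cut_ranks_finite_nonempty[OF G assms(4-6), of es, where ?'a = 'a]
  have R: "finite ?R" "?R \<noteq> {}" by (rule system_ranks_finite_nonempty)+
  have le: "r \<le> c" if "r \<in> ?R" "c \<in> ?C" for r c
    using that rank_system_matrix_le_cut[OF assms(1-3)] by blast
  \<comment> \<open>The offset \<open>card (ports G)\<close> translates ranks into the dimensions of
    the invariant and avoids subtraction of natural numbers.\<close>
  have init: "Min ?C + card (ports G) \<le> fv.dim (gens G (\<lambda>_. 0 :: 'a) {} \<Omega> (nodes G - \<Omega>)) + card (outs G \<Omega>)"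
    if "is_cut G S T \<Omega>" for \<Omega>
  proof -
    have "Min ?C \<le> mat_rank (cut_matrix G es \<Omega> :: 'a mat)"
      using C(1) that by (intro Min_le) auto
    then show ?thesis
      using rank_cut_le_dim_gens[OF G assms(2,3), of \<Omega>, where ?'a = 'a] that
      by (simp add: is_cut_def)
  qed
  obtain \<beta> :: "'p \<times> 'p \<Rightarrow> 'a" where \<beta>: "Min ?C + card (ports G)
      \<le> fv.dim (gens G \<beta> (nodes G - {S, T}) {S} {T}) + card (outputs G S)"
    by (rule coefficients_exist[OF G assms(4-6) init])
  obtain \<alpha> \<nu> and \<beta>' :: "'p \<times> 'p \<Rightarrow> 'a" and \<epsilon> where
    "fv.dim (gens G \<beta> (nodes G - {S, T}) {S} {T}) + card (outputs G S)
      \<le> mat_rank (system_matrix G es S T (card (outputs G S)) \<nu> \<alpha> \<beta>' \<epsilon>) + card (ports G)"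
    by (rule rank_system_matrix_ge_dim_gens[OF assms])
  with \<beta> have "Min ?C \<le> mat_rank (system_matrix G es S T (card (outputs G S)) \<nu> \<alpha> \<beta>' \<epsilon>)"
    by linarith
  also have "\<dots> \<le> Max ?R" by (intro Max_ge[OF R(1)]) blast
  finally have "Min ?C \<le> Max ?R" .
  moreover have "Max ?R \<le> Min ?C" using le[OF Max_in[OF R] Min_in[OF C]] .
  ultimately show "Min ?C = Max ?R" by (rule order_antisym)
qed (simp add: mincut_def)

end
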